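(* Let $[0,1)^d+T$ be a cube tiling of $\mathbb{R}^d$. If $r^+(T)>2^{d-3}/3$, then there is a twin pair in the tiling $[0,1)^d+T$.
   Context: A cube tiling of $\mathbb{R}^d$ is a family of pairwise disjoint cubes $[0,1)^d+T=\{[0,1)^d+t:t\in T\}$, $T\subset\mathbb{R}^d$, with $\bigcup_{t\in T}([0,1)^d+t)=\mathbb{R}^d$. Two cubes $[0,1)^d+t$, $[0,1)^d+s$ form a twin pair if there is $j\in[d]=\{1,\dots,d\}$ with $|t_j-s_j|=1$ and $t_i=s_i$ for every $i\in[d]\setminus\{j\}$. For $x\in\mathbb{R}^d$ and $i\in[d]$, $L(T,x,i)$ is the set of all $i$th coordinates $t_i$ of vectors $t\in T$ such that $([0,1)^d+t)\cap([0,1]^d+x)\neq\emptyset$ and $t_i\le x_i$. (It is known that $1\le|L(T,x,i)|\le 2^{d-1}$.) Put $r^+(T)=\max_{x\in\mathbb{R}^d}\max_{1\le i\le d}|L(T,x,i)|$. *)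

theory Defs
  imports "HOL-Analysis.Analysis"
begin

text \<open>
  The space \<open>\<real>\<^sup>d\<close> is \<open>real ^ 'n\<close> with \<open>d = CARD('n)\<close>;
  the index set \<open>[d]\<close> is the finite type \<open>'n\<close>.
\<close>

definition half_open_cube :: "(real ^ 'n) set" where
  "half_open_cube = {y. \<forall>i. 0 \<le> y $ i \<and> y $ i < 1}"

definition closed_cube :: "(real ^ 'n) set" where
  "closed_cube = {y. \<forall>i. 0 \<le> y $ i \<and> y $ i \<le> 1}"

definition translate :: "(real ^ 'n) set \<Rightarrow> real ^ 'n \<Rightarrow> (real ^ 'n) set" where
  "translate A t = (\<lambda>y. y + t) ` A"

definition cube_tiling :: "(real ^ 'n) set \<Rightarrow> bool" where
  "cube_tiling T \<longleftrightarrow>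
     disjoint_family_on (translate half_open_cube) T \<and>
     (\<Union>t\<in>T. translate half_open_cube t) = UNIV"

definition twin_pair :: "real ^ 'n \<Rightarrow> real ^ 'n \<Rightarrow> bool" where
  "twin_pair t s \<longleftrightarrow> (\<exists>j. \<bar>t $ j - s $ j\<bar> = 1 \<and> (\<forall>i. i \<noteq> j \<longrightarrow> t $ i = s $ i))"

definition L :: "(real ^ 'n) set \<Rightarrow> real ^ 'n \<Rightarrow> 'n \<Rightarrow> real set" where
  "L T x i = {t $ i | t. t \<in> T \<and>
     translate half_open_cube t \<inter> translate closed_cube x \<noteq> {} \<and> t $ i \<le> x $ i}"

text \<open>
  \<^const>\<open>Max\<close> and \<^const>\<open>card\<close> are meaningful only on finite sets. For a cube tiling all sets
  involved are finite: the cubes contributing to \<open>L T x i\<close> are disjoint unit cubes contained in a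
  cube of side 3, so there are at most \<open>3\<^sup>d\<close> of them, uniformly in \<open>x\<close> and \<open>i\<close>.
\<close>

definition r_plus :: "(real ^ 'n) set \<Rightarrow> nat" where
  "r_plus T = (MAX x. MAX i. card (L T x i))"

end

theory Submission
  imports Defs
begin

text \<open>
  Fix a point \<open>x\<close>. A cube of the tiling that meets \<open>[0,1]\<^sup>d + x\<close> is recorded as a word: its letter at
  coordinate \<open>i\<close> is the class of \<open>t\<^sub>i\<close> modulo 1 together with one bit telling which of the two
  possible representatives \<open>t\<^sub>i\<close> is. Since a whole class of cubes can be shifted along a coordinate
  without destroying the tiling, the words partition the space of all choices of one bit per
  coordinate and class. Words whose letters at \<open>i\<close> are the two letters of a fixed class therefore
  form, after deletion of the coordinate \<open>i\<close>, two codes \<open>V\<close> and \<open>W\<close> with the same union. If there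
  are no twin pairs, these codes are disjoint and twin free, and the heart of the proof is that then
  \<open>V\<close> has at least 12 words. There are \<open>2\<^bsup>d\<^esup>\<close> words in all and each class
  accounts for at least 24 of them, hence there are at most \<open>2\<^bsup>d-3\<^esup> / 3\<close> classes.

  For the bound 12, at some coordinate at least two classes occur, and each of them is shown to
  contribute at least 6. A box that is covered by a twin free code in a nontrivial way needs at least
  5 boxes; this leaves few configurations in which a class contributes at most 5, and each of
  them leads to a twin pair.
\<close>

section \<open>Words and codes\<close>

type_synonym 'c letter = "'c \<times> bool"

definition opp :: "'c letter \<Rightarrow> 'c letter" where
  "opp l = (fst l, \<not> snd l)"

definition cyl :: "('n \<Rightarrow> 'c letter) \<Rightarrow> ('n \<Rightarrow> 'c \<Rightarrow> bool) set" where
  "cyl w = {\<omega>. \<forall>i. \<omega> i (fst (w i)) = snd (w i)}"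

definition region :: "('n \<Rightarrow> 'c letter) set \<Rightarrow> ('n \<Rightarrow> 'c \<Rightarrow> bool) set" where
  "region V = (\<Union>v\<in>V. cyl v)"

definition clash :: "('n \<Rightarrow> 'c letter) \<Rightarrow> ('n \<Rightarrow> 'c letter) \<Rightarrow> bool" where
  "clash v w \<longleftrightarrow> (\<exists>i. w i = opp (v i))"

definition code :: "('n \<Rightarrow> 'c letter) set \<Rightarrow> bool" where
  "code V \<longleftrightarrow> (\<forall>v\<in>V. \<forall>w\<in>V. v \<noteq> w \<longrightarrow> clash v w)"

definition twin_free :: "('n \<Rightarrow> 'c letter) set \<Rightarrow> bool" where
  "twin_free V \<longleftrightarrow> (\<forall>v\<in>V. \<forall>j. v(j := opp (v j)) \<notin> V)"

definition slice :: "('n \<Rightarrow> 'c letter) set \<Rightarrow> 'n \<Rightarrow> 'c letter \<Rightarrow> ('n \<Rightarrow> 'c letter) set" where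
  "slice V i l = {v \<in> V. v i = l}"

text \<open>The words with letter \<^term>\<open>opp l\<close> at \<open>i\<close>, rewritten to have letter \<open>l\<close> there: this replaces
  the deletion of the coordinate \<open>i\<close>, so that \<open>slice\<close> and \<open>opp_slice\<close> can be compared.\<close>

definition opp_slice :: "('n \<Rightarrow> 'c letter) set \<Rightarrow> 'n \<Rightarrow> 'c letter \<Rightarrow> ('n \<Rightarrow> 'c letter) set" where
  "opp_slice V i l = {u. u i = l \<and> u(i := opp l) \<in> V}"

text \<open>Counterpart of shifting the cubes of class \<open>c\<close> by 1 along
  \<open>i\<close>.\<close>

definition flip :: "'n \<Rightarrow> 'c \<Rightarrow> ('n \<Rightarrow> 'c \<Rightarrow> bool) \<Rightarrow> 'n \<Rightarrow> 'c \<Rightarrow> bool" where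
  "flip i c \<omega> = \<omega> (i := (\<omega> i)(c := (\<not> \<omega> i c)))"

lemma opp_simps [simp]: "fst (opp l) = fst l" "snd (opp l) \<longleftrightarrow> \<not> snd l" "opp (opp l) = l"
  "opp l \<noteq> l" "l \<noteq> opp l"
  by (cases l; auto simp: opp_def)+

lemma opp_eq_iff [simp]: "opp a = opp b \<longleftrightarrow> a = b"
  by (metis opp_simps(3))

lemma same_type: "fst a = fst b \<longleftrightarrow> a = b \<or> a = opp b"
  by (cases a; cases b) (auto simp: opp_def)

lemma clash_sym: "clash v w \<longleftrightarrow> clash w v"
  unfolding clash_def by (metis opp_simps(3))

lemma clash_irrefl [simp]: "\<not> clash v v"
  by (auto simp: clash_def)

lemma cylD: "\<omega> \<in> cyl w \<Longrightarrow> \<omega> i (fst (w i)) = snd (w i)"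
  by (auto simp: cyl_def)

text \<open>Without opposite letters, one point can take the bits of \<open>v\<close> at its classes
  and those of \<open>w\<close> elsewhere.\<close>

lemma clash_cyl: "clash v w \<longleftrightarrow> cyl v \<inter> cyl w = {}"
proof
  assume "clash v w"
  then obtain i where "w i = opp (v i)" by (auto simp: clash_def)
  then show "cyl v \<inter> cyl w = {}" by (auto simp: cyl_def dest!: spec[of _ i])
next
  assume e: "cyl v \<inter> cyl w = {}"
  show "clash v w"
  proof (rule ccontr)
    assume "\<not> clash v w"
    then have "fst (v i) = fst (w i) \<Longrightarrow> v i = w i" for i
      unfolding clash_def same_type by (metis opp_simps(3))
    then have "(\<lambda>i c. if c = fst (v i) then snd (v i) else snd (w i)) \<in> cyl v \<inter> cyl w"
      unfolding cyl_def by simp metis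
    with e show False by blast
  qed
qed

lemma clash_eqI: "\<omega> \<in> cyl v \<Longrightarrow> \<omega> \<in> cyl w \<Longrightarrow> \<not> clash v w"
  using clash_cyl by fastforce

lemma code_eqI: "code V \<Longrightarrow> v \<in> V \<Longrightarrow> w \<in> V \<Longrightarrow> \<omega> \<in> cyl v \<Longrightarrow> \<omega> \<in> cyl w \<Longrightarrow> v = w"
  unfolding code_def using clash_eqI by blast

lemma code_subset: "code V \<Longrightarrow> W \<subseteq> V \<Longrightarrow> code W"
  by (auto simp: code_def)

lemma twin_free_subset: "twin_free V \<Longrightarrow> W \<subseteq> V \<Longrightarrow> twin_free W"
  by (auto simp: twin_free_def)

lemma regionE: assumes "\<omega> \<in> region V" obtains v where "v \<in> V" "\<omega> \<in> cyl v"
  using assms by (auto simp: region_def)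

lemma regionI: "v \<in> V \<Longrightarrow> \<omega> \<in> cyl v \<Longrightarrow> \<omega> \<in> region V"
  by (auto simp: region_def)

lemma cyl_nonempty: obtains \<omega> where "\<omega> \<in> cyl v"
  using clash_cyl[of v v] by auto

lemma not_clash_point: assumes "\<not> clash v w" obtains \<omega> where "\<omega> \<in> cyl v" "\<omega> \<in> cyl w"
  using assms clash_cyl by blast

lemma flip_flip [simp]: "flip i c (flip i c \<omega>) = \<omega>"
  by (auto simp: flip_def)

lemma flip_cyl: "fst (w i) \<noteq> c \<Longrightarrow> flip i c \<omega> \<in> cyl w \<longleftrightarrow> \<omega> \<in> cyl w"
  unfolding cyl_def flip_def mem_Collect_eq
  by (intro all_cong1) auto

lemma flip_cyl_same: "fst (w i) = c \<Longrightarrow> flip i c \<omega> \<in> cyl w \<longleftrightarrow> \<omega> \<in> cyl (w(i := opp (w i)))"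
  unfolding cyl_def flip_def mem_Collect_eq
  by (intro all_cong1) auto

lemma cyl_upd_cong: "\<omega> \<in> cyl w \<Longrightarrow> \<omega> i (fst l) = snd l \<Longrightarrow> \<omega> \<in> cyl (w(i := l))"
  by (auto simp: cyl_def)

text \<open>If \<open>c q\<close> came from neither word, flipping the bit it prescribes would keep
  a common point in both boxes but move it out of \<open>cyl c\<close>.\<close>

lemma cyl_Int_subset:
  assumes "cyl v \<inter> cyl x \<subseteq> cyl c" "\<not> clash v x"
  shows "c q = v q \<or> c q = x q"
proof (rule ccontr)
  assume n: "\<not> (c q = v q \<or> c q = x q)"
  obtain \<omega> where w: "\<omega> \<in> cyl v" "\<omega> \<in> cyl x" using assms not_clash_point by blast
  with assms have c: "\<omega> \<in> cyl c" by blast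
  have "fst (c q) \<noteq> fst (v q)" "fst (c q) \<noteq> fst (x q)"
    using n cylD[OF w(1), of q] cylD[OF w(2), of q] cylD[OF c, of q] by (auto simp: prod_eq_iff)
  then have "flip q (fst (c q)) \<omega> \<in> cyl v \<inter> cyl x" using w by (auto simp: flip_cyl)
  then have "flip q (fst (c q)) \<omega> \<in> cyl c" using assms by blast
  then show False using cylD[OF c, of q] cylD[of "flip q (fst (c q)) \<omega>" c q] by (auto simp: flip_def)
qed

text \<open>By \<open>cyl_Int_subset\<close> in both directions, differing letters at
  \<open>q\<close> would both equal \<open>e q\<close>.\<close>

lemma cyl_Int_eq:
  assumes "cyl y \<inter> cyl e = cyl z \<inter> cyl e" "\<not> clash y e" "\<not> clash z e"
  shows "y = z"
proof
  fix q
  have "z q = y q \<or> z q = e q" "y q = z q \<or> y q = e q"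
    using cyl_Int_subset[of y e z q] cyl_Int_subset[of z e y q] assms by auto
  then show "y q = z q" by auto
qed

lemma cyl_subset_eq: "cyl v \<subseteq> cyl c \<Longrightarrow> c = v"
  using cyl_Int_subset[of v v c] by auto

text \<open>The flip of \<open>cyl_Int_subset\<close> again: as \<open>q\<close> is not
  \<open>p\<close>, the flipped point keeps the bit at \<open>p\<close> that excludes it from
  \<open>cyl d\<close>.\<close>

lemma cyl_Int_subset_Un:
  assumes "cyl v \<inter> cyl x \<subseteq> cyl c \<union> cyl d" "d p = opp (c p)" "q \<noteq> p"
    and "\<omega> \<in> cyl v" "\<omega> \<in> cyl x" "\<omega> \<in> cyl c"
  shows "c q = v q \<or> c q = x q"
proof (rule ccontr)
  assume n: "\<not> (c q = v q \<or> c q = x q)"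
  note w = assms(4-6)
  have "fst (c q) \<noteq> fst (v q)" "fst (c q) \<noteq> fst (x q)"
    using n cylD[OF w(1), of q] cylD[OF w(2), of q] cylD[OF w(3), of q] by (auto simp: prod_eq_iff)
  then have "flip q (fst (c q)) \<omega> \<in> cyl v \<inter> cyl x" using w by (auto simp: flip_cyl)
  then have "flip q (fst (c q)) \<omega> \<in> cyl c \<union> cyl d" using assms by blast
  then show False
    using cylD[OF w(3), of q] cylD[OF w(3), of p] \<open>q \<noteq> p\<close> assms(2)
      cylD[of "flip q (fst (c q)) \<omega>" c q] cylD[of "flip q (fst (c q)) \<omega>" d p]
    by (auto simp: flip_def)
qed

text \<open>Evaluating a point of the code space at equal bits for all classes of a coordinate
  identifies the words of a code with Boolean vectors.\<close>

lemma card_code: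
  assumes "code V"
  shows "card V = card {\<beta>. (\<lambda>i c. \<beta> i) \<in> region V}" "inj_on (\<lambda>v. snd \<circ> v) V"
proof -
  have b: "(\<lambda>i c. \<beta> i) \<in> cyl v \<longleftrightarrow> \<beta> = snd \<circ> v" for \<beta> and v :: "'a \<Rightarrow> 'b letter"
    by (auto simp: cyl_def)
  then have "(\<lambda>v. snd \<circ> v) ` V = {\<beta>. (\<lambda>i c. \<beta> i) \<in> region V}"
    by (auto simp: region_def)
  moreover show i: "inj_on (\<lambda>v. snd \<circ> v) V"
    by (rule inj_onI) (metis b code_eqI[OF assms])
  ultimately show "card V = card {\<beta>. (\<lambda>i c. \<beta> i) \<in> region V}"
    by (metis card_image)
qed

lemma finite_code: "code V \<Longrightarrow> finite (V :: ('n::finite \<Rightarrow> 'c letter) set)"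
  using card_code(2)[of V] by (rule inj_on_finite[where B = UNIV]) auto

section \<open>Slices of a code at a letter\<close>

lemma code_slice: "code V \<Longrightarrow> code (slice V i l)"
  by (rule code_subset) (auto simp: slice_def)

lemma twin_free_slice: "twin_free V \<Longrightarrow> twin_free (slice V i l)"
  by (rule twin_free_subset) (auto simp: slice_def)

lemma code_opp_slice: assumes "code V" shows "code (opp_slice V i l)"
  unfolding code_def
proof (intro ballI impI)
  fix v w assume a: "v \<in> opp_slice V i l" "w \<in> opp_slice V i l" "v \<noteq> w"
  then have "v(i := opp l) \<noteq> w(i := opp l)"
    unfolding opp_slice_def mem_Collect_eq by (metis fun_upd_triv fun_upd_upd)
  with a assms have "clash (v(i := opp l)) (w(i := opp l))" by (auto simp: code_def opp_slice_def)
  then show "clash v w" unfolding clash_def by (auto split: if_splits)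
qed

lemma twin_free_opp_slice: assumes "twin_free V" shows "twin_free (opp_slice V i l)"
  unfolding twin_free_def
proof (intro ballI allI notI)
  fix v j assume a: "v \<in> opp_slice V i l" "v(j := opp (v j)) \<in> opp_slice V i l"
  then have "j \<noteq> i" by (auto simp: opp_slice_def)
  then have "(v(i := opp l))(j := opp ((v(i := opp l)) j)) \<in> V"
    using a by (auto simp: opp_slice_def fun_upd_twist)
  then show False using a assms unfolding twin_free_def opp_slice_def by blast
qed

lemma card_opp_slice: "card (opp_slice V i l) = card (slice V i (opp l))"
  by (rule bij_betw_same_card[of "\<lambda>u. u(i := opp l)"],
      rule bij_betw_byWitness[where f' = "\<lambda>u. u(i := l)"])
    (auto simp: opp_slice_def slice_def fun_eq_iff fun_upd_idem)

lemma slice_opp_slice_disjoint: "twin_free V \<Longrightarrow> slice V i l \<inter> opp_slice V i l = {}"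
  unfolding twin_free_def slice_def opp_slice_def by blast

lemma opp_slice_slice_disjoint: "twin_free V \<Longrightarrow> opp_slice V i l \<inter> slice V i l = {}"
  using slice_opp_slice_disjoint by fastforce

text \<open>A word of another class at \<open>i\<close> that covers the flipped point would also
  cover \<open>\<omega>\<close>, hence equal the word of the slice there.\<close>

lemma flip_in_opp_slice:
  assumes "code V" "\<omega> \<in> region (slice V i l)" "flip i (fst l) \<omega> \<in> region V"
  shows "\<omega> \<in> region (opp_slice V i l)"
proof -
  obtain v where v: "v \<in> V" "v i = l" "\<omega> \<in> cyl v" using assms(2) by (auto simp: region_def slice_def)
  obtain u where u: "u \<in> V" "flip i (fst l) \<omega> \<in> cyl u" using assms(3) by (auto simp: region_def)
  have t: "fst (u i) = fst l"
  proof (rule ccontr)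
    assume n: "fst (u i) \<noteq> fst l"
    with u have "\<omega> \<in> cyl u" by (simp add: flip_cyl)
    with v u assms(1) have "u = v" using code_eqI by blast
    with n v show False by simp
  qed
  then have w: "\<omega> \<in> cyl (u(i := opp (u i)))" using u flip_cyl_same[of u i "fst l" \<omega>] by simp
  have "u i \<noteq> l"
    using cylD[OF w, of i] cylD[OF v(3), of i] v(2) by (auto simp: opp_def)
  with t have "u i = opp l" by (auto simp: same_type)
  then show ?thesis using w u by (intro regionI[of "u(i := l)"]) (auto simp: opp_slice_def fun_upd_idem)
qed

lemma flip_opp_slice:
  assumes "\<omega> \<in> region (opp_slice V i l)"
  shows "flip i (fst l) \<omega> \<in> region V" "\<omega> i (fst l) = snd l"
proof -
  obtain u where u: "u i = l" "u(i := opp l) \<in> V" "\<omega> \<in> cyl u"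
    using assms by (auto simp: region_def opp_slice_def)
  show "\<omega> i (fst l) = snd l" using cylD[OF u(3), of i] u by simp
  have "flip i (fst l) \<omega> \<in> cyl (u(i := opp l))"
    using u by (subst flip_cyl_same) (auto simp: fun_upd_idem)
  with u show "flip i (fst l) \<omega> \<in> region V" by (auto simp: region_def)
qed

lemma flip_in_slice:
  assumes "code V" "\<omega> \<in> region (opp_slice V i l)" "\<omega> \<in> region V"
  shows "\<omega> \<in> region (slice V i l)"
proof -
  obtain u where u: "u i = l" "u(i := opp l) \<in> V" "\<omega> \<in> cyl u"
    using assms by (auto simp: region_def opp_slice_def)
  have f: "flip i (fst l) \<omega> \<in> cyl (u(i := opp l))"
    using u by (subst flip_cyl_same) (auto simp: fun_upd_idem)
  obtain v where v: "v \<in> V" "\<omega> \<in> cyl v" using assms(3) by (auto simp: region_def)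
  have t: "fst (v i) = fst l"
  proof (rule ccontr)
    assume n: "fst (v i) \<noteq> fst l"
    with v have "flip i (fst l) \<omega> \<in> cyl v" by (simp add: flip_cyl)
    then have "v = u(i := opp l)" using f v u assms(1) code_eqI by blast
    with n show False by simp
  qed
  have "v i = l" using cylD[OF v(2), of i] cylD[OF u(3), of i] u t by (auto simp: prod_eq_iff)
  with v show ?thesis by (auto simp: region_def slice_def)
qed

lemma region_sliceD: "\<omega> \<in> region (slice V i l) \<Longrightarrow> \<omega> \<in> region V"
  by (auto simp: region_def slice_def)

lemma region_slice_bit: "\<omega> \<in> region (slice V i l) \<Longrightarrow> \<omega> i (fst l) = snd l"
  by (auto simp: region_def slice_def cyl_def)

lemma region_sliceI: "\<omega> \<in> region V \<Longrightarrow> \<omega> i (fst l) = snd l \<Longrightarrow> flip i (fst l) \<omega> \<notin> region V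
  \<Longrightarrow> \<omega> \<in> region (slice V i l)"
proof -
  assume a: "\<omega> \<in> region V" "\<omega> i (fst l) = snd l" "flip i (fst l) \<omega> \<notin> region V"
  then obtain v where v: "v \<in> V" "\<omega> \<in> cyl v" by (auto simp: region_def)
  with a have "fst (v i) = fst l" using flip_cyl regionI by metis
  then have "v i = l" using cylD[OF v(2), of i] a by (auto simp: prod_eq_iff)
  with v show ?thesis by (auto simp: region_def slice_def)
qed

lemma region_opp_sliceI: "\<omega> \<notin> region V \<Longrightarrow> \<omega> i (fst l) = snd l \<Longrightarrow> flip i (fst l) \<omega> \<in> region V
  \<Longrightarrow> \<omega> \<in> region (opp_slice V i l)"
proof -
  assume a: "\<omega> \<notin> region V" "\<omega> i (fst l) = snd l" "flip i (fst l) \<omega> \<in> region V"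
  then obtain v where v: "v \<in> V" "flip i (fst l) \<omega> \<in> cyl v" by (auto simp: region_def)
  with a have t: "fst (v i) = fst l" using flip_cyl regionI by metis
  with v have w: "\<omega> \<in> cyl (v(i := opp (v i)))" using flip_cyl_same by metis
  then have "v i = opp l" using cylD[OF w, of i] a t by (auto simp: prod_eq_iff)
  with v w show ?thesis
    by (intro regionI[of "v(i := l)"]) (auto simp: opp_slice_def fun_upd_idem)
qed

lemma slice_eq_opp_slice_on:
  assumes "code V" "fst (e j) \<noteq> fst l"
    and "\<And>\<omega>. \<omega> \<in> cyl e \<Longrightarrow> \<omega> \<in> region V \<Longrightarrow> flip j (fst l) \<omega> \<in> region V"
  shows "region (slice V j l) \<inter> cyl e = region (opp_slice V j l) \<inter> cyl e"
proof (intro equalityI subsetI IntI; elim IntE)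
  fix \<omega> assume a: "\<omega> \<in> region (slice V j l)" "\<omega> \<in> cyl e"
  then have "\<omega> \<in> region V" by (simp add: region_sliceD)
  with a assms show "\<omega> \<in> region (opp_slice V j l)" using flip_in_opp_slice by metis
next
  fix \<omega> assume a: "\<omega> \<in> region (opp_slice V j l)" "\<omega> \<in> cyl e"
  then have "flip j (fst l) \<omega> \<in> region V" "flip j (fst l) \<omega> \<in> cyl e"
    using flip_opp_slice(1) flip_cyl[of e j] assms(2) by metis+
  from assms(3)[OF this(2,1)] have "\<omega> \<in> region V" by simp
  with a assms show "\<omega> \<in> region (slice V j l)" using flip_in_slice by metis
qed

lemma slices_card:
  assumes "finite V"
  shows "card (slice V j l) + card (slice V j (opp l)) = card {v \<in> V. fst (v j) = fst l}"
proof -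
  have "{v \<in> V. fst (v j) = fst l} = slice V j l \<union> slice V j (opp l)"
    by (auto simp: slice_def same_type)
  moreover have "slice V j l \<inter> slice V j (opp l) = {}" by (auto simp: slice_def)
  ultimately show ?thesis using assms by (simp add: card_Un_disjoint slice_def)
qed

lemma not_clash_opp_slice:
  assumes "\<And>d. d \<in> V \<Longrightarrow> \<not> clash d e" "d \<in> opp_slice V j l" "fst (e j) \<noteq> fst l"
  shows "\<not> clash d e"
  using assms unfolding opp_slice_def clash_def mem_Collect_eq
  by (metis fun_upd_other fun_upd_same opp_simps(1))

section \<open>Covers by twin free codes\<close>

text \<open>The box \<open>cyl e\<close> is the ambient space here: coordinates at which a word agrees with \<open>e\<close> are
  unconstrained, so this concerns partitions of \<open>cyl x \<inter> cyl e\<close> into smaller boxes. If \<open>j\<close> is a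
  coordinate with two opposite letters, the two slices at \<open>j\<close> have the same union off \<open>j\<close>, and
  one of them has at most two words.\<close>

lemma cover_card:
  fixes D :: "('n::finite \<Rightarrow> 'c letter) set"
  assumes "code D" "twin_free D" "D \<noteq> {}" "\<And>d. d \<in> D \<Longrightarrow> \<not> clash d e"
    and "region D \<inter> cyl e = cyl x \<inter> cyl e"
  shows "card D = 1 \<or> card D \<ge> 5"
  using assms
proof (induction "card D" arbitrary: D x rule: less_induct)
  case less
  note D = less.prems
  have fin: "finite D" using D(1) by (rule finite_code)
  show ?case
  proof (rule ccontr)
    assume n: "\<not> (card D = 1 \<or> card D \<ge> 5)"
    obtain d1 where d1: "d1 \<in> D" using D(3) by blast
    have "D \<noteq> {d1}" using n by auto
    then obtain d2 where d2: "d2 \<in> D" "d2 \<noteq> d1" using d1 by blast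
    with d1 D(1) have "clash d1 d2" by (auto simp: code_def)
    then obtain j where j: "d2 j = opp (d1 j)" by (auto simp: clash_def)
    define l where "l = d1 j"
    have ej: "fst (e j) \<noteq> fst l"
      using D(4)[OF d1] D(4)[OF d2(1)] j unfolding l_def clash_def same_type
      by (auto dest!: spec[of _ j])
    have sub: "cyl d \<inter> cyl e \<subseteq> cyl x" if "d \<in> D" for d
      using that D(5) by (auto simp: region_def)
    have "x j = d1 j \<or> x j = e j" "x j = d2 j \<or> x j = e j"
      using cyl_Int_subset[OF sub[OF d1] D(4)[OF d1]] cyl_Int_subset[OF sub[OF d2(1)] D(4)[OF d2(1)]]
      by auto
    \<comment> \<open>Two opposite letters cannot both be \<open>x j\<close>, which leaves
      \<open>e j\<close>.\<close>
    then have xj: "x j = e j" using j by auto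
    let ?P = "slice D j l" and ?Q = "opp_slice D j l"
    have closed: "flip j (fst l) \<omega> \<in> region D" if "\<omega> \<in> cyl e" "\<omega> \<in> region D" for \<omega>
    proof -
      have "\<omega> \<in> cyl x" using that D(5) by blast
      then have "flip j (fst l) \<omega> \<in> cyl x \<inter> cyl e" using that xj ej by (simp add: flip_cyl)
      then show ?thesis using D(5) by blast
    qed
    have eq: "region ?P \<inter> cyl e = region ?Q \<inter> cyl e"
      by (rule slice_eq_opp_slice_on) (use D ej closed in auto)
    have PQ: "code ?P" "code ?Q" "twin_free ?P" "twin_free ?Q" "?P \<inter> ?Q = {}"
      using D(1,2) by (simp_all add: code_slice code_opp_slice twin_free_slice twin_free_opp_slice
        slice_opp_slice_disjoint opp_slice_slice_disjoint)
    have "d1 \<in> ?P" using d1 by (simp add: slice_def l_def)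
    moreover have "d2(j := opp l) = d2" using j by (simp add: l_def fun_upd_idem)
    then have "d2(j := l) \<in> ?Q" using d2 by (simp add: opp_slice_def)
    ultimately have ne: "?P \<noteq> {}" "?Q \<noteq> {}" by auto
    have ncP: "\<not> clash d e" if "d \<in> ?P" for d using that D(4)[of d] by (simp add: slice_def)
    have ncQ: "\<not> clash d e" if "d \<in> ?Q" for d using D(4) that ej by (rule not_clash_opp_slice)
    have finPQ: "finite ?P" "finite ?Q" using PQ(1,2) by (auto intro: finite_code)
    have sum: "card ?P + card ?Q \<le> card D"
      unfolding card_opp_slice slices_card[OF fin] by (rule card_mono) (use fin in auto)
    have pos: "card ?P > 0" "card ?Q > 0" using ne finPQ by (auto simp: card_gt_0_iff)
    \<comment> \<open>The other slice has 1 or at least 5 words by induction; 5 are too many, and a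
      single one would be the same word by \<open>cyl_Int_eq\<close>.\<close>
    have single: False if "card S = 1" "card S' < card D" "code S'" "twin_free S'" "S' \<noteq> {}"
      "\<And>d. d \<in> S' \<Longrightarrow> \<not> clash d e" "\<And>d. d \<in> S \<Longrightarrow> \<not> clash d e" "S \<inter> S' = {}"
      "region S' \<inter> cyl e = region S \<inter> cyl e" for S S'
    proof -
      note card_S = that(1)
      obtain y where y: "S = {y}" using card_S card_1_singletonE by blast
      have r: "region S' \<inter> cyl e = cyl y \<inter> cyl e" using that y by (simp add: region_def)
      from less.hyps[OF that(2-6) r] n that(2) have "card S' = 1" by linarith
      then obtain z where z: "S' = {z}" using card_1_singletonE by blast
      have "z = y" by (rule cyl_Int_eq[of _ e]) (use r z y that(6,7) in \<open>auto simp: region_def\<close>)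
      with y z that show False by simp
    qed
    have lt: "card ?P < card D" "card ?Q < card D" using sum pos by linarith+
    have QP: "?Q \<inter> ?P = {}" using PQ(5) by blast
    have "card ?P \<noteq> 1"
      using single[OF _ lt(2) PQ(2,4) ne(2) ncQ ncP PQ(5) eq[symmetric]] by blast
    moreover have "card ?Q \<noteq> 1"
      using single[OF _ lt(1) PQ(1,3) ne(1) ncP ncQ QP eq] by blast
    \<comment> \<open>Without a singleton slice only 2 + 2 is left, so every word of
      \<open>D\<close> has the class of \<open>l\<close> at \<open>j\<close>, and a slice would
      split a box into two, against the induction hypothesis.\<close>
    ultimately have c: "card ?P = 2" "card D = 4" "card ?P + card ?Q = card D" using sum pos n by linarith+
    have all: "fst (v j) = fst l" if "v \<in> D" for v
    proof -
      have "{v \<in> D. fst (v j) = fst l} = D"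
        by (rule card_subset_eq) (use fin c slices_card[OF fin, of j l] card_opp_slice[of D j l] in auto)
      with that show ?thesis by blast
    qed
    have "region ?P \<inter> cyl e = cyl (x(j := l)) \<inter> cyl e"
    proof (intro equalityI subsetI IntI; elim IntE)
      fix \<omega> assume a: "\<omega> \<in> region ?P" "\<omega> \<in> cyl e"
      then have "\<omega> \<in> cyl x" using D(5) region_sliceD[OF a(1)] by blast
      with a show "\<omega> \<in> cyl (x(j := l))" using cyl_upd_cong region_slice_bit by metis
    next
      fix \<omega> assume a: "\<omega> \<in> cyl (x(j := l))" "\<omega> \<in> cyl e"
      then have "\<omega> \<in> cyl ((x(j := l))(j := e j))" using cyl_upd_cong cylD by metis
      then have "\<omega> \<in> region D" using a D(5) xj by (auto simp: fun_upd_idem)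
      then obtain v where v: "v \<in> D" "\<omega> \<in> cyl v" by (auto simp: region_def)
      have "v j = l" using all[OF v(1)] cylD[OF v(2), of j] cylD[OF a(1), of j] by (auto simp: prod_eq_iff)
      with v show "\<omega> \<in> region ?P" by (auto simp: region_def slice_def)
    qed
    from less.hyps[OF _ PQ(1,3) ne(1) ncP this] c show False by linarith
  qed
qed

text \<open>\<open>cover_card\<close> with \<open>x = e\<close>; a single covering word would be
  \<open>e\<close> itself.\<close>

lemma cover_word_card:
  fixes D :: "('n::finite \<Rightarrow> 'c letter) set"
  assumes "code D" "twin_free D" "e \<notin> D" "cyl e \<subseteq> region D"
  shows "card {d \<in> D. \<not> clash d e} \<ge> 5"
proof -
  let ?D = "{d \<in> D. \<not> clash d e}"
  have r: "region ?D \<inter> cyl e = cyl e \<inter> cyl e"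
    using assms(4) clash_eqI by (fastforce simp: region_def)
  obtain \<omega> where "\<omega> \<in> cyl e" using cyl_nonempty by blast
  with r have "\<omega> \<in> region ?D" by blast
  then have ne: "?D \<noteq> {}" by (auto simp: region_def)
  have c: "code ?D" "twin_free ?D"
    using code_subset[OF assms(1)] twin_free_subset[OF assms(2)] by auto
  have "card ?D \<noteq> 1"
  proof
    assume "card ?D = 1"
    then obtain d where d: "?D = {d}" using card_1_singletonE by blast
    with r have "cyl e \<subseteq> cyl d" by (auto simp: region_def)
    then show False using cyl_subset_eq d assms(3) by blast
  qed
  with cover_card[OF c ne _ r] show ?thesis by auto
qed

text \<open>Words with the same trace on \<open>cyl e\<close> are equal, so a single word of
  \<open>P\<close> is split by \<open>Q\<close>, and \<open>cover_card\<close> leaves at least 5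
  pieces.\<close>

lemma equal_covers_card:
  fixes P Q :: "('n::finite \<Rightarrow> 'c letter) set"
  assumes "code Q" "twin_free Q" "P \<inter> Q = {}" "P \<noteq> {}"
    and "\<And>d. d \<in> P \<Longrightarrow> \<not> clash d e" "\<And>d. d \<in> Q \<Longrightarrow> \<not> clash d e"
    and eq: "region P \<inter> cyl e = region Q \<inter> cyl e"
  shows "Q \<noteq> {}" "card P = 1 \<Longrightarrow> card Q \<ge> 5"
proof -
  obtain p where p: "p \<in> P" using assms by blast
  then obtain \<omega> where "\<omega> \<in> cyl p" "\<omega> \<in> cyl e" using assms(5) not_clash_point by metis
  then have "\<omega> \<in> region Q" using p eq regionI by blast
  then show ne: "Q \<noteq> {}" by (auto simp: region_def)
  assume "card P = 1"
  then obtain y where y: "P = {y}" using card_1_singletonE by blast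
  then have r: "region Q \<inter> cyl e = cyl y \<inter> cyl e" using eq by (simp add: region_def)
  have "card Q \<noteq> 1"
  proof
    assume "card Q = 1"
    then obtain z where z: "Q = {z}" using card_1_singletonE by blast
    have "z = y" by (rule cyl_Int_eq[of _ e]) (use r z y assms(5,6) in \<open>auto simp: region_def\<close>)
    with y z assms show False by simp
  qed
  with cover_card[OF assms(1,2) ne assms(6) r] show "card Q \<ge> 5" by auto
qed

text \<open>Both slices have the same trace on \<open>cyl e\<close>, so by
  \<open>equal_covers_card\<close> each has at least 2 words or one of them has at least 5.\<close>

lemma slice_cover_card:
  fixes D :: "('n::finite \<Rightarrow> 'c letter) set"
  assumes "code D" "twin_free D" "\<And>d. d \<in> D \<Longrightarrow> \<not> clash d e" "fst (e j) \<noteq> fst l"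
    and "\<And>\<omega>. \<omega> \<in> cyl e \<Longrightarrow> \<omega> \<in> region D \<Longrightarrow> flip j (fst l) \<omega> \<in> region D"
    and "slice D j l \<noteq> {}"
  shows "card D \<ge> 4"
proof -
  let ?P = "slice D j l" and ?Q = "opp_slice D j l"
  have eq: "region ?P \<inter> cyl e = region ?Q \<inter> cyl e"
    by (rule slice_eq_opp_slice_on) (use assms in auto)
  have PQ: "code ?P" "code ?Q" "twin_free ?P" "twin_free ?Q" "?P \<inter> ?Q = {}" "?Q \<inter> ?P = {}"
    using assms(1,2) by (simp_all add: code_slice code_opp_slice twin_free_slice twin_free_opp_slice
        slice_opp_slice_disjoint opp_slice_slice_disjoint)
  have ncP: "\<not> clash d e" if "d \<in> ?P" for d using that assms(3)[of d] by (simp add: slice_def)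
  have ncQ: "\<not> clash d e" if "d \<in> ?Q" for d using assms(3) that assms(4) by (rule not_clash_opp_slice)
  note 1 = equal_covers_card[OF PQ(2,4,5) assms(6) ncP ncQ eq]
  note 2 = equal_covers_card[OF PQ(1,3,6) 1(1) ncQ ncP eq[symmetric]]
  have fin: "finite D" "finite ?P" "finite ?Q" using PQ(1,2) assms(1) by (auto intro: finite_code)
  have "card ?P + card ?Q \<le> card D"
    unfolding card_opp_slice slices_card[OF fin(1)] by (rule card_mono) (use fin in auto)
  moreover have "card ?P > 0" "card ?Q > 0" using assms(6) 1(1) fin by (auto simp: card_gt_0_iff)
  ultimately show ?thesis using 1(2) 2(2) by linarith
qed

text \<open>Each word of \<open>E\<close> needs 5 words of \<open>D\<close>, hence all. A clash in
  \<open>D\<close> at \<open>j\<close> then forces another class at \<open>j\<close> on all of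
  \<open>E\<close>, so the slices of \<open>D\<close> at \<open>j\<close> have equal unions;
  covering \<open>d1\<close> by the opposite slice takes 5 words besides \<open>d1\<close>.\<close>

lemma small_region_unique:
  fixes D :: "('n::finite \<Rightarrow> 'c letter) set"
  assumes D: "code D" "twin_free D" "card D \<le> 5" and E: "code E" "D \<inter> E = {}" "region D = region E"
  shows "D = {}"
proof (rule ccontr)
  assume "D \<noteq> {}"
  have fin: "finite D" using D(1) by (rule finite_code)
  have all: "\<not> clash d e" if "e \<in> E" "d \<in> D" for d e
  proof -
    have "cyl e \<subseteq> region D" using that E by (auto simp: region_def)
    with cover_word_card[OF D(1,2), of e] that E have "card {d \<in> D. \<not> clash d e} \<ge> 5" by blast
    with D(3) fin have "{d \<in> D. \<not> clash d e} = D" by (intro card_seteq) auto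
    with that show ?thesis by blast
  qed
  obtain d1 where d1: "d1 \<in> D" using \<open>D \<noteq> {}\<close> by blast
  obtain \<omega> where "\<omega> \<in> cyl d1" using cyl_nonempty by blast
  then have "\<omega> \<in> region E" using d1 E(3) regionI by blast
  then obtain e where e: "e \<in> E" by (rule regionE)
  have "cyl e \<subseteq> region D" using e E by (auto simp: region_def)
  with cover_word_card[OF D(1,2), of e] e E have "card {d \<in> D. \<not> clash d e} \<ge> 5" by blast
  moreover have "card {d \<in> D. \<not> clash d e} \<le> card D" by (rule card_mono) (use fin in auto)
  ultimately have "card D = 5" using D(3) by linarith
  then have "D \<noteq> {d1}" by auto
  then obtain d2 where d2: "d2 \<in> D" "d2 \<noteq> d1" using d1 by blast
  with d1 D(1) have "clash d1 d2" by (auto simp: code_def)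
  then obtain j where j: "d2 j = opp (d1 j)" by (auto simp: clash_def)
  let ?l = "d1 j"
  have ej: "fst (e' j) \<noteq> fst ?l" if "e' \<in> E" for e'
    using all[OF that d1] all[OF that d2(1)] j unfolding clash_def same_type
    by (auto dest!: spec[of _ j])
  let ?P = "slice D j ?l" and ?Q = "opp_slice D j ?l"
  have PQ: "code ?P" "code ?Q" "twin_free ?P" "twin_free ?Q" "?P \<inter> ?Q = {}"
    using D(1,2) by (simp_all add: code_slice code_opp_slice twin_free_slice twin_free_opp_slice
        slice_opp_slice_disjoint opp_slice_slice_disjoint)
  have d1P: "d1 \<in> ?P" using d1 by (simp add: slice_def)
  have "cyl d1 \<subseteq> region ?Q"
  proof
    fix \<omega> assume w: "\<omega> \<in> cyl d1"
    then have "\<omega> \<in> region E" using d1 E(3) by (auto simp: region_def)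
    then obtain e' where e': "e' \<in> E" "\<omega> \<in> cyl e'" by (auto simp: region_def)
    then have "flip j (fst ?l) \<omega> \<in> cyl e'" using ej[OF e'(1)] by (simp add: flip_cyl)
    then have "flip j (fst ?l) \<omega> \<in> region D" using e' E(3) by (auto simp: region_def)
    then show "\<omega> \<in> region ?Q"
      using flip_in_opp_slice[OF D(1)] w d1P regionI by metis
  qed
  with cover_word_card[OF PQ(2,4), of d1] d1P PQ(5) have "card {d \<in> ?Q. \<not> clash d d1} \<ge> 5" by blast
  moreover have "card {d \<in> ?Q. \<not> clash d d1} \<le> card ?Q"
    by (rule card_mono) (use PQ finite_code in auto)
  moreover have "card ?P > 0" using d1P PQ(1) finite_code card_gt_0_iff by blast
  moreover have "card ?P + card ?Q \<le> card D"
    unfolding card_opp_slice slices_card[OF fin] by (rule card_mono) (use fin in auto)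
  ultimately show False using D(3) by linarith
qed

section \<open>Disjoint twin free codes with equal union\<close>

text \<open>Models the two slices of a twin free partition at one class: equal unions since
  everything is covered, disjoint since a common word would yield twins.\<close>

definition rival :: "('n \<Rightarrow> 'c letter) set \<Rightarrow> ('n \<Rightarrow> 'c letter) set \<Rightarrow> bool" where
  "rival V W \<longleftrightarrow> code V \<and> code W \<and> twin_free V \<and> twin_free W \<and> V \<inter> W = {} \<and> region V = region W"

text \<open>Symmetric in \<open>V\<close> and \<open>W\<close>, and in \<open>l\<close> and \<open>opp l\<close>, for rivals (\<open>mass_swap\<close>, \<open>mass_opp\<close>); the sum
  of the masses over the classes at \<open>i\<close> is the number of words of \<open>V\<close>.\<close>

definition mass :: "('n \<Rightarrow> 'c letter) set \<Rightarrow> ('n \<Rightarrow> 'c letter) set \<Rightarrow> 'n \<Rightarrow> 'c letter \<Rightarrow> nat" where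
  "mass V W i l = card (slice V i l) + card (slice W i (opp l))"

text \<open>A near pair of rivals forces heavy classes directly by \<open>near_mass\<close>; its
  absence is what \<open>half_cover\<close> needs.\<close>

definition near :: "('n \<Rightarrow> 'c letter) \<Rightarrow> ('n \<Rightarrow> 'c letter) \<Rightarrow> bool" where
  "near v w \<longleftrightarrow> \<not> clash v w \<and> (\<exists>j z. w = v(j := z))"

lemma rival_sym: "rival V W \<Longrightarrow> rival W V"
  by (auto simp: rival_def)

lemma near_sym: "near v w \<Longrightarrow> near w v"
  unfolding near_def using clash_sym by (metis fun_upd_triv fun_upd_upd)

lemma rival_slices:
  assumes "rival V W"
  shows "code (slice V i l)" "code (slice W i l)" "code (opp_slice V i l)" "code (opp_slice W i l)"
    "twin_free (slice V i l)" "twin_free (slice W i l)" "twin_free (opp_slice V i l)" "twin_free (opp_slice W i l)"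
    "slice V i l \<inter> slice W i l = {}" "opp_slice V i l \<inter> opp_slice W i l = {}"
    "slice V i l \<inter> opp_slice V i l = {}" "slice W i l \<inter> opp_slice W i l = {}"
proof -
  have r: "code V" "code W" "twin_free V" "twin_free W" "V \<inter> W = {}" using assms by (auto simp: rival_def)
  show "code (slice V i l)" "code (slice W i l)" "code (opp_slice V i l)" "code (opp_slice W i l)"
    "twin_free (slice V i l)" "twin_free (slice W i l)" "twin_free (opp_slice V i l)" "twin_free (opp_slice W i l)"
    using r code_slice code_opp_slice twin_free_slice twin_free_opp_slice by metis+
  show "slice V i l \<inter> slice W i l = {}" "opp_slice V i l \<inter> opp_slice W i l = {}"
    using r by (auto simp: slice_def opp_slice_def)
  show "slice V i l \<inter> opp_slice V i l = {}" "slice W i l \<inter> opp_slice W i l = {}"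
    using r slice_opp_slice_disjoint by metis+
qed

lemma region_empty_iff: "region V = {} \<longleftrightarrow> V = {}"
proof
  assume r: "region V = {}"
  show "V = {}"
  proof (rule equals0I)
    fix v assume "v \<in> V"
    moreover obtain \<omega> where "\<omega> \<in> cyl v" using cyl_nonempty by blast
    ultimately show False using r regionI by fastforce
  qed
qed (simp add: region_def)

lemma slice_status:
  assumes "code V" "\<omega> i (fst l) = snd l"
  shows "\<omega> \<in> region V \<Longrightarrow> flip i (fst l) \<omega> \<in> region V \<Longrightarrow>
      \<omega> \<in> region (slice V i l) \<longleftrightarrow> \<omega> \<in> region (opp_slice V i l)"
    and "\<omega> \<in> region V \<Longrightarrow> flip i (fst l) \<omega> \<notin> region V \<Longrightarrow>
      \<omega> \<in> region (slice V i l) \<and> \<omega> \<notin> region (opp_slice V i l)"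
    and "\<omega> \<notin> region V \<Longrightarrow> flip i (fst l) \<omega> \<in> region V \<Longrightarrow>
      \<omega> \<notin> region (slice V i l) \<and> \<omega> \<in> region (opp_slice V i l)"
    and "\<omega> \<notin> region V \<Longrightarrow> flip i (fst l) \<omega> \<notin> region V \<Longrightarrow>
      \<omega> \<notin> region (slice V i l) \<and> \<omega> \<notin> region (opp_slice V i l)"
  using assms(2) flip_in_slice[OF assms(1), of \<omega> i l] flip_in_opp_slice[OF assms(1), of \<omega> i l]
    region_sliceI[of \<omega> V i l] region_opp_sliceI[of \<omega> V i l] flip_opp_slice(1)[of \<omega> V i l]
    region_sliceD[of \<omega> V i l] by argo+

text \<open>The indicator functions of the four unions satisfy
  \<open>slice V + opp_slice W = slice W + opp_slice V\<close>.\<close>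

lemma slices_balance:
  assumes "rival V W"
  shows "region (slice V i l) \<union> region (opp_slice W i l) = region (slice W i l) \<union> region (opp_slice V i l)"
    and "region (slice V i l) \<inter> region (opp_slice W i l) = region (slice W i l) \<inter> region (opp_slice V i l)"
proof -
  have r: "code V" "code W" "region V = region W" using assms by (auto simp: rival_def)
  have "(\<omega> \<in> region (slice V i l) \<union> region (opp_slice W i l)) =
      (\<omega> \<in> region (slice W i l) \<union> region (opp_slice V i l)) \<and>
      (\<omega> \<in> region (slice V i l) \<inter> region (opp_slice W i l)) =
      (\<omega> \<in> region (slice W i l) \<inter> region (opp_slice V i l))" for \<omega>
  proof (cases "\<omega> i (fst l) = snd l")
    case True
    show ?thesis
      using slice_status[of V \<omega> i l, OF r(1) True] slice_status[of W \<omega> i l, OF r(2) True] r(3)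
      by (cases "\<omega> \<in> region V"; cases "flip i (fst l) \<omega> \<in> region V") auto
  next
    case False
    then show ?thesis
      using region_slice_bit[of \<omega> V i l] region_slice_bit[of \<omega> W i l]
        flip_opp_slice(2)[of \<omega> V i l] flip_opp_slice(2)[of \<omega> W i l] by auto
  qed
  then show "region (slice V i l) \<union> region (opp_slice W i l) = region (slice W i l) \<union> region (opp_slice V i l)"
    "region (slice V i l) \<inter> region (opp_slice W i l) = region (slice W i l) \<inter> region (opp_slice V i l)"
    by blast+
qed

text \<open>Count the points of \<open>slices_balance\<close> whose bits depend on the coordinate
  only; by \<open>card_code\<close> these counts are numbers of words.\<close>

lemma mass_swap:
  fixes V W :: "('n::finite \<Rightarrow> 'c letter) set"
  assumes "rival V W"
  shows "mass W V i l = mass V W i l"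
proof -
  define S where "S V = {\<beta>. (\<lambda>i c. \<beta> i) \<in> region V}" for V :: "('n \<Rightarrow> 'c letter) set"
  note c = rival_slices[OF assms, of i l]
  have eq: "S (slice V i l) \<union> S (opp_slice W i l) = S (slice W i l) \<union> S (opp_slice V i l)"
    "S (slice V i l) \<inter> S (opp_slice W i l) = S (slice W i l) \<inter> S (opp_slice V i l)"
    using slices_balance[OF assms, of i l] by (auto simp: S_def)
  have "card (slice V i l) + card (opp_slice W i l) = card (slice W i l) + card (opp_slice V i l)"
    using card_Un_Int[of "S (slice V i l)" "S (opp_slice W i l)"]
      card_Un_Int[of "S (slice W i l)" "S (opp_slice V i l)"] eq c(1-4)
    by (simp add: card_code(1) S_def)
  then show ?thesis by (simp add: mass_def card_opp_slice)
qed

lemma mass_opp: "mass V W i (opp l) = mass W V i l"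
  by (simp add: mass_def)

lemma mass_alt: "mass V W i l = card (slice V i l) + card (opp_slice W i l)"
  by (simp add: mass_def card_opp_slice)

lemma slice_eq_opp_slice_rival:
  assumes "rival V W" "w \<in> W" "fst (w i) \<noteq> fst l" "\<omega> \<in> cyl w"
  shows "\<omega> \<in> region (slice V i l) \<longleftrightarrow> \<omega> \<in> region (opp_slice V i l)"
proof -
  have r: "code V" "region V = region W" using assms by (auto simp: rival_def)
  have "flip i (fst l) \<omega> \<in> cyl w" using assms(3,4) by (simp add: flip_cyl)
  then have "\<omega> \<in> region V" "flip i (fst l) \<omega> \<in> region V"
    using assms(2,4) r regionI[of w W] by simp_all
  then show ?thesis
    using slice_status(1)[OF r(1), of \<omega> i l] region_slice_bit[of \<omega> V i l]
      flip_opp_slice(2)[of \<omega> V i l] by argo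
qed

lemma cover_outside_slice:
  assumes "rival V W" "\<omega> \<in> region (slice V i l)" "\<omega> \<notin> region (slice W i l)"
  obtains w where "w \<in> W" "fst (w i) \<noteq> fst l" "\<omega> \<in> cyl w"
proof -
  have "\<omega> \<in> region W" using assms region_sliceD[OF assms(2)] by (simp add: rival_def)
  then obtain w where w: "w \<in> W" "\<omega> \<in> cyl w" by (auto simp: region_def)
  have "fst (w i) \<noteq> fst l"
  proof
    assume "fst (w i) = fst l"
    then have "w i = l" using cylD[OF w(2), of i] region_slice_bit[OF assms(2)] by (auto simp: prod_eq_iff)
    with w assms(3) show False by (auto simp: region_def slice_def)
  qed
  with w that show thesis by blast
qed

text \<open>Inside \<open>cyl w\<close> the slice and the opposite slice of \<open>V\<close> have
  the same trace, since \<open>w\<close> covers a point together with its flip;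
  \<open>equal_covers_card\<close> applies both ways.\<close>

lemma slice_covers:
  fixes V W :: "('n::finite \<Rightarrow> 'c letter) set"
  assumes "rival V W" "w \<in> W" "fst (w i) \<noteq> fst l"
  defines "A \<equiv> {a \<in> slice V i l. \<not> clash a w}" and "D \<equiv> {d \<in> opp_slice V i l. \<not> clash d w}"
  shows "region A \<inter> cyl w = region D \<inter> cyl w"
    and "A \<noteq> {} \<Longrightarrow> D \<noteq> {}"
    and "A \<noteq> {} \<Longrightarrow> card A \<ge> 2 \<or> card D \<ge> 5"
    and "A \<noteq> {} \<Longrightarrow> card D \<ge> 2 \<or> card A \<ge> 5"
    and "card A \<le> card (slice V i l)" "card D \<le> card (opp_slice V i l)"
proof -
  note c = rival_slices[OF assms(1), of i l]
  have nc: "\<And>d. d \<in> A \<Longrightarrow> \<not> clash d w" "\<And>d. d \<in> D \<Longrightarrow> \<not> clash d w" by (auto simp: A_def D_def)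
  have AD: "A \<subseteq> slice V i l" "D \<subseteq> opp_slice V i l" by (auto simp: A_def D_def)
  have "\<omega> \<in> region A \<longleftrightarrow> \<omega> \<in> region (slice V i l)" "\<omega> \<in> region D \<longleftrightarrow> \<omega> \<in> region (opp_slice V i l)"
    if "\<omega> \<in> cyl w" for \<omega>
    using that clash_eqI unfolding A_def D_def region_def by blast+
  then show eq: "region A \<inter> cyl w = region D \<inter> cyl w"
    using slice_eq_opp_slice_rival[OF assms(1-3)] by blast
  have fin: "finite (slice V i l)" "finite (opp_slice V i l)" using c(1,3) by (auto intro: finite_code)
  then show "card A \<le> card (slice V i l)" "card D \<le> card (opp_slice V i l)"
    using AD by (auto intro: card_mono)
  have AD': "code A" "twin_free A" "code D" "twin_free D" "A \<inter> D = {}" "D \<inter> A = {}"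
    using c(11) AD code_subset[OF c(1) AD(1)] code_subset[OF c(3) AD(2)]
      twin_free_subset[OF c(5) AD(1)] twin_free_subset[OF c(7) AD(2)] by blast+
  assume ne: "A \<noteq> {}"
  note 1 = equal_covers_card[OF AD'(3,4,5) ne nc eq]
  note 2 = equal_covers_card[OF AD'(1,2,6) 1(1) nc(2,1) eq[symmetric]]
  show "D \<noteq> {}" by (rule 1(1))
  have "card A > 0" "card D > 0"
    using ne 1(1) finite_code[OF AD'(1)] finite_code[OF AD'(3)] by (auto simp: card_gt_0_iff)
  then show "card A \<ge> 2 \<or> card D \<ge> 5" "card D \<ge> 2 \<or> card A \<ge> 5"
    using 1(2) 2(2) by linarith+
qed

section \<open>Classes of mass at most five\<close>

text \<open>junk\<close>

lemma slice_nonempty: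
  fixes V W :: "('n::finite \<Rightarrow> 'c letter) set"
  assumes R: "rival V W" and m: "mass V W i l \<le> 5" and v: "v \<in> V \<union> W" "fst (v i) = fst l"
  shows "slice W i l \<noteq> {}"
proof
  assume C: "slice W i l = {}"
  note c = rival_slices[OF R, of i l]
  let ?A = "slice V i l" and ?B = "opp_slice W i l" and ?D = "opp_slice V i l"
  \<comment> \<open>With \<open>slice W i l\<close> empty, \<open>?A\<close> and \<open>?B\<close>
    partition the union of the code \<open>?D\<close>, whose size is the mass by
    \<open>mass_swap\<close>: a case of \<open>small_region_unique\<close>.\<close>
  have b: "region ?A \<union> region ?B = region ?D" "region ?A \<inter> region ?B = {}"
    using slices_balance[OF R, of i l] C by (auto simp: region_def)
  have "code (?A \<union> ?B)"
    unfolding code_def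
  proof (intro ballI impI)
    fix v w assume vw: "v \<in> ?A \<union> ?B" "w \<in> ?A \<union> ?B" "v \<noteq> w"
    have "clash v w" "clash w v" if "v \<in> ?A" "w \<in> ?B" for v w
      using that b(2) by (auto simp: region_def clash_cyl)
    with vw c(1,4) show "clash v w" unfolding code_def by blast
  qed
  moreover have "card ?D \<le> 5"
    using m mass_swap[OF R, of i l] C by (simp add: mass_alt)
  moreover have "region ?D = region (?A \<union> ?B)" using b by (auto simp: region_def)
  moreover have "?D \<inter> (?A \<union> ?B) = {}" using c(10,11) by blast
  ultimately have D: "?D = {}" using small_region_unique[OF c(3,7)] by simp
  then have "region ?A = {}" "region ?B = {}" using b by (auto simp: region_def)
  then have "?A = {}" "?B = {}" by (auto simp: region_empty_iff)
  with C D have "slice V i l = {}" "slice W i l = {}" "slice V i (opp l) = {}" "slice W i (opp l) = {}"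
    using card_opp_slice[of V i l] card_opp_slice[of W i l] c(3,4)
      finite_code[OF code_slice, of V i "opp l"] finite_code[OF code_slice, of W i "opp l"] R
    by (auto simp: rival_def)
  with v show False by (auto simp: slice_def same_type)
qed

lemma slices_pos:
  fixes V W :: "('n::finite \<Rightarrow> 'c letter) set"
  assumes R: "rival V W" and m: "mass V W i l \<le> 5" and v: "v \<in> V \<union> W" "fst (v i) = fst l"
  shows "card (slice V i l) \<ge> 1" "card (slice W i l) \<ge> 1"
    "card (opp_slice V i l) \<ge> 1" "card (opp_slice W i l) \<ge> 1"
proof -
  have R': "rival W V" using R by (rule rival_sym)
  have m': "mass W V i l \<le> 5" "mass V W i (opp l) \<le> 5" "mass W V i (opp l) \<le> 5"
    using m mass_swap[OF R, of i l] mass_opp[of V W i l] mass_opp[of W V i l] by simp_all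
  have v': "v \<in> W \<union> V" "fst (v i) = fst (opp l)" using v by auto
  have "slice W i l \<noteq> {}" "slice V i l \<noteq> {}" "slice W i (opp l) \<noteq> {}" "slice V i (opp l) \<noteq> {}"
    using slice_nonempty[OF R m v] slice_nonempty[OF R' m'(1) v'(1) v(2)]
      slice_nonempty[OF R m'(2) v(1) v'(2)] slice_nonempty[OF R' m'(3) v'] by simp_all
  moreover have "finite V" "finite W" using R by (auto simp: rival_def intro: finite_code)
  ultimately show "card (slice V i l) \<ge> 1" "card (slice W i l) \<ge> 1"
    "card (opp_slice V i l) \<ge> 1" "card (opp_slice W i l) \<ge> 1"
    by (auto simp: card_opp_slice Suc_le_eq card_gt_0_iff slice_def)
qed

text \<open>All four slices are nonempty and two sums of two sizes are at most 5, so no slice has 5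
  words and only the alternatives with 2 survive in \<open>slice_covers\<close>.\<close>

lemma crossing_cards:
  fixes V W :: "('n::finite \<Rightarrow> 'c letter) set"
  assumes R: "rival V W" and m: "mass V W i l \<le> 5" and v: "v \<in> V \<union> W" "fst (v i) = fst l"
    and w: "w \<in> W" "fst (w i) \<noteq> fst l" and A: "{a \<in> slice V i l. \<not> clash a w} \<noteq> {}"
  shows "card {a \<in> slice V i l. \<not> clash a w} \<ge> 2" "card {d \<in> opp_slice V i l. \<not> clash d w} \<ge> 2"
proof -
  note p = slices_pos[OF R m v]
  note c = slice_covers[OF R w]
  have "card (slice V i l) + card (opp_slice W i l) \<le> 5" "card (slice W i l) + card (opp_slice V i l) \<le> 5"
    using m mass_swap[OF R, of i l] by (simp_all add: mass_alt)
  then show "card {a \<in> slice V i l. \<not> clash a w} \<ge> 2" "card {d \<in> opp_slice V i l. \<not> clash d w} \<ge> 2"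
    using c(3)[OF A] c(4)[OF A] c(5,6) p by linarith+
qed

text \<open>At most 4 words of \<open>slice W i l\<close> cannot cover a word of
  \<open>slice V i l\<close>, by \<open>cover_word_card\<close>; words of another class fill the
  gap.\<close>

lemma crossing_exists:
  fixes V W :: "('n::finite \<Rightarrow> 'c letter) set"
  assumes R: "rival V W" and m: "mass V W i l \<le> 5" and v: "v \<in> V \<union> W" "fst (v i) = fst l"
  obtains w where "w \<in> W" "fst (w i) \<noteq> fst l" "{a \<in> slice V i l. \<not> clash a w} \<noteq> {}"
proof -
  note p = slices_pos[OF R m v]
  note c = rival_slices[OF R, of i l]
  obtain a where a: "a \<in> slice V i l" using p(1) by fastforce
  have "\<not> cyl a \<subseteq> region (slice W i l)"
  proof
    assume "cyl a \<subseteq> region (slice W i l)"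
    moreover have "a \<notin> slice W i l" using a c(9) by auto
    ultimately have "card {d \<in> slice W i l. \<not> clash d a} \<ge> 5"
      using cover_word_card[OF c(2,6)] by blast
    moreover have "card {d \<in> slice W i l. \<not> clash d a} \<le> card (slice W i l)"
      by (rule card_mono) (auto simp: finite_code[OF c(2)])
    ultimately show False
      using m mass_swap[OF R, of i l] p(3) by (simp add: mass_alt)
  qed
  then obtain \<omega> where w: "\<omega> \<in> cyl a" "\<omega> \<notin> region (slice W i l)" by blast
  then have "\<omega> \<in> region (slice V i l)" using a regionI by blast
  from cover_outside_slice[OF R this w(2)] obtain w where "w \<in> W" "fst (w i) \<noteq> fst l" "\<omega> \<in> cyl w"
    by blast
  with w(1) a that clash_eqI[of \<omega> a w] show thesis by blast
qed

lemma slices_ge_2: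
  fixes V W :: "('n::finite \<Rightarrow> 'c letter) set"
  assumes R: "rival V W" and m: "mass V W i l \<le> 5" and v: "v \<in> V \<union> W" "fst (v i) = fst l"
  shows "card (slice V i l) \<ge> 2" "card (opp_slice V i l) \<ge> 2"
proof -
  obtain w where w: "w \<in> W" "fst (w i) \<noteq> fst l" "{a \<in> slice V i l. \<not> clash a w} \<noteq> {}"
    using crossing_exists[OF R m v] by blast
  then show "card (slice V i l) \<ge> 2" "card (opp_slice V i l) \<ge> 2"
    using crossing_cards[OF R m v w] slice_covers(5,6)[OF R w(1,2)] by linarith+
qed

text \<open>Any other word of the slice clashes with \<open>v\<close> away from \<open>i\<close>,
  where \<open>v\<close> and \<open>w\<close> agree. So only \<open>v\<close> meets
  \<open>w\<close>, against \<open>crossing_cards\<close>.\<close>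

lemma near_mass:
  fixes V W :: "('n::finite \<Rightarrow> 'c letter) set"
  assumes R: "rival V W" and vw: "v \<in> V" "w \<in> W" "\<not> clash v w" "w = v(i := z)"
  shows "mass V W i (v i) \<ge> 6"
proof (rule ccontr)
  assume "\<not> ?thesis"
  then have m: "mass V W i (v i) \<le> 5" by simp
  have "z \<noteq> v i" using R vw by (auto simp: rival_def)
  moreover have "w i \<noteq> opp (v i)" using vw(3) by (auto simp: clash_def)
  then have "z \<noteq> opp (v i)" using vw(4) by simp
  ultimately have z: "fst (w i) \<noteq> fst (v i)" using vw(4) by (simp add: same_type)
  have V: "v \<in> V \<union> W" "fst (v i) = fst (v i)" using vw by auto
  let ?A = "{a \<in> slice V i (v i). \<not> clash a w}"
  have "?A = {v}"
  proof (intro equalityI subsetI)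
    fix a assume a: "a \<in> ?A"
    show "a \<in> {v}"
    proof (rule ccontr)
      assume "a \<notin> {v}"
      then have "clash a v" using a vw R by (auto simp: slice_def rival_def code_def)
      then obtain q where q: "v q = opp (a q)" by (auto simp: clash_def)
      with a have "q \<noteq> i" by (auto simp: slice_def)
      with q vw(4) have "clash a w" by (auto simp: clash_def)
      with a show False by blast
    qed
  qed (use vw in \<open>auto simp: slice_def\<close>)
  with crossing_cards(1)[OF R m V vw(2) z] show False by simp
qed

text \<open>Two boxes partitioning a half of \<open>cyl v\<close> differ in one coordinate only, unless one of them is near \<open>v\<close>.\<close>

lemma half_cover:
  fixes C :: "('n::finite \<Rightarrow> 'c letter) set"
  assumes C: "code C" "twin_free C" "card C \<le> 2" and b: "fst b \<noteq> fst (v j)"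
    and cov: "cyl v \<inter> cyl (v(j := b)) \<subseteq> region C" and n: "\<And>c. c \<in> C \<Longrightarrow> \<not> near v c"
  shows False
proof -
  let ?x = "v(j := b)"
  have fin: "finite C" using C(1) by (rule finite_code)
  have nc: "\<not> clash v ?x" using b by (auto simp: clash_def same_type)
  have nocov: "\<not> cyl v \<inter> cyl ?x \<subseteq> cyl c" if c: "c \<in> C" for c
  proof
    assume s: "cyl v \<inter> cyl ?x \<subseteq> cyl c"
    have "c = v(j := c j)"
    proof
      fix q show "c q = (v(j := c j)) q" using cyl_Int_subset[OF s nc, of q] by auto
    qed
    moreover obtain \<omega> where "\<omega> \<in> cyl v" "\<omega> \<in> cyl ?x" using nc not_clash_point by blast
    then have "\<not> clash v c" using s clash_eqI[of \<omega> v c] by blast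
    ultimately have "near v c" unfolding near_def by blast
    with n[OF c] show False by simp
  qed
  obtain \<omega> where w: "\<omega> \<in> cyl v" "\<omega> \<in> cyl ?x" using nc not_clash_point by blast
  then have "\<omega> \<in> region C" using cov by blast
  then obtain c where c: "c \<in> C" "\<omega> \<in> cyl c" by (rule regionE)
  obtain \<omega>' where w': "\<omega>' \<in> cyl v" "\<omega>' \<in> cyl ?x" "\<omega>' \<notin> cyl c" using nocov[OF c(1)] by blast
  then have "\<omega>' \<in> region C" using cov by blast
  then obtain d where d: "d \<in> C" "\<omega>' \<in> cyl d" by (rule regionE)
  have cd: "c \<noteq> d" using d w' by auto
  have "C = {c, d}"
    by (rule card_seteq[symmetric]) (use fin c d cd C(3) in auto)
  then have s: "cyl v \<inter> cyl ?x \<subseteq> cyl c \<union> cyl d" "cyl v \<inter> cyl ?x \<subseteq> cyl d \<union> cyl c"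
    using cov by (auto simp: region_def)
  obtain p where p: "d p = opp (c p)" using C(1) c d cd by (auto simp: code_def clash_def)
  then have p': "c p = opp (d p)" by simp
  have cq: "c q = v q \<or> c q = ?x q" and dq: "d q = v q \<or> d q = ?x q" if "q \<noteq> p" for q
    using cyl_Int_subset_Un[OF s(1) p that w c(2)] cyl_Int_subset_Un[OF s(2) p' that w'(1,2) d(2)] by auto
  \<comment> \<open>Away from \<open>p\<close> each word agrees with \<open>v\<close>, except for a
    possible \<open>b\<close> at \<open>j\<close>. Without that \<open>b\<close> it is near
    \<open>v\<close>; with it in both words, they are twins at \<open>p\<close>.\<close>
  have far: "e j = b" if e: "e \<in> C" "\<omega>'' \<in> cyl v" "\<omega>'' \<in> cyl e" "\<And>q. q \<noteq> p \<Longrightarrow> e q = v q \<or> e q = ?x q" for e \<omega>''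
  proof (rule ccontr)
    assume "e j \<noteq> b"
    have "e = v(p := e p)"
    proof
      fix q show "e q = (v(p := e p)) q" using e(4)[of q] \<open>e j \<noteq> b\<close> by (cases "q = j") auto
    qed
    then have "near v e" unfolding near_def using clash_eqI[OF e(2,3)] by blast
    with n[OF e(1)] show False by simp
  qed
  have cj: "c j = b" "d j = b" using far[OF c(1) w(1) c(2) cq] far[OF d(1) w'(1) d(2) dq] by auto
  have "d = c(p := opp (c p))"
  proof
    fix q show "d q = (c(p := opp (c p))) q" using cq[of q] dq[of q] cj p by (cases "q = j") auto
  qed
  with C(2) c d show False by (auto simp: twin_free_def)
qed

section \<open>Classes with a slice of two words\<close>

definition crossing where
  "crossing V W i l w \<longleftrightarrow> w \<in> W \<and> fst (w i) \<noteq> fst l \<and> (\<exists>a\<in>slice V i l. \<not> clash a w)"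

definition opp_meeting where
  "opp_meeting V i l w = {d \<in> opp_slice V i l. \<not> clash d w}"

context
  fixes V W :: "('n::finite \<Rightarrow> 'c letter) set" and i l v1 v2 j
  assumes R: "rival V W" and m: "mass V W i l \<le> 5"
    and A: "slice V i l = {v1, v2}" and D: "card (opp_slice V i l) \<le> 3" and j: "v2 j = opp (v1 j)"
begin

lemma slice_pair_in: "v1 \<in> V" "v2 \<in> V" "v1 i = l" "v2 i = l"
  using A by (auto simp: slice_def)

text \<open>\<open>crossing_cards\<close> needs two words meeting \<open>w\<close>, so both do;
  being opposite at \<open>j\<close>, they force another class on \<open>w j\<close>.\<close>

lemma crossing_facts:
  assumes w: "crossing V W i l w"
  shows "\<not> clash v1 w" "\<not> clash v2 w" "fst (w j) \<noteq> fst (v1 j)" "fst (w j) \<noteq> fst (v2 j)"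
    "card (opp_meeting V i l w) \<ge> 2" "card (opp_meeting V i l w) \<le> 3" "region {v1, v2} \<inter> cyl w = region (opp_meeting V i l w) \<inter> cyl w"
proof -
  have w': "w \<in> W" "fst (w i) \<noteq> fst l" "{a \<in> slice V i l. \<not> clash a w} \<noteq> {}"
    using w A by (auto simp: crossing_def)
  have v: "v1 \<in> V \<union> W" "fst (v1 i) = fst l" using slice_pair_in by auto
  note c = crossing_cards[OF R m v w'] slice_covers[OF R w'(1,2)]
  have "{a \<in> slice V i l. \<not> clash a w} = {v1, v2}"
    by (rule card_seteq) (use A c(1) in \<open>auto simp: card_insert_if\<close>)
  then show nc: "\<not> clash v1 w" "\<not> clash v2 w" and "region {v1, v2} \<inter> cyl w = region (opp_meeting V i l w) \<inter> cyl w"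
    using c(3) by (auto simp: opp_meeting_def)
  show "fst (w j) \<noteq> fst (v1 j)" "fst (w j) \<noteq> fst (v2 j)"
    using nc j by (auto simp: clash_def same_type dest!: spec[of _ j])
  show "card (opp_meeting V i l w) \<ge> 2" "card (opp_meeting V i l w) \<le> 3"
    using c(2,8) D by (auto simp: opp_meeting_def)
qed

lemma opp_meeting_code: "code (opp_meeting V i l w)" "twin_free (opp_meeting V i l w)" "d \<in> opp_meeting V i l w \<Longrightarrow> \<not> clash d w" "finite (opp_meeting V i l w)"
  "v1 \<notin> opp_meeting V i l w" "v2 \<notin> opp_meeting V i l w"
proof -
  note c = rival_slices[OF R, of i l]
  have s: "opp_meeting V i l w \<subseteq> opp_slice V i l" by (auto simp: opp_meeting_def)
  show "code (opp_meeting V i l w)" "twin_free (opp_meeting V i l w)" using code_subset[OF c(3) s] twin_free_subset[OF c(7) s] .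
  then show "finite (opp_meeting V i l w)" by (auto intro: finite_code)
  show "d \<in> opp_meeting V i l w \<Longrightarrow> \<not> clash d w" by (simp add: opp_meeting_def)
  show "v1 \<notin> opp_meeting V i l w" "v2 \<notin> opp_meeting V i l w" using c(11) A s by auto
qed

lemma slice_pair_code: "code {v1, v2}" "twin_free {v1, v2}" "card {v1, v2} = 2"
proof -
  note c = rival_slices[OF R, of i l]
  show "code {v1, v2}" "twin_free {v1, v2}" using c(1,5) A by simp_all
  have "v1 \<noteq> v2" using j by auto
  then show "card {v1, v2} = 2" by simp
qed

text \<open>Flipping the bit of a third class at \<open>j\<close> preserves the traces of
  \<open>v1\<close> and \<open>v2\<close>, so \<open>slice_cover_card\<close> would give 4 words
  among at most 3.\<close>

lemma opp_meeting_letters: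
  assumes w: "crossing V W i l w" and y: "y \<in> opp_meeting V i l w"
  shows "y j = w j \<or> fst (y j) = fst (v1 j)"
proof (rule ccontr)
  assume n: "\<not> ?thesis"
  note f = crossing_facts[OF w]
  have t: "fst (w j) \<noteq> fst (y j)"
    using n opp_meeting_code(3)[OF y] by (auto simp: clash_def same_type)
  have "card (opp_meeting V i l w) \<ge> 4"
  proof (rule slice_cover_card[where e = w and j = j and l = "y j", OF opp_meeting_code(1,2) _ t])
    fix \<omega> assume a: "\<omega> \<in> cyl w" "\<omega> \<in> region (opp_meeting V i l w)"
    then have "\<omega> \<in> region {v1, v2}" using f(7) by blast
    then obtain v where v: "v \<in> {v1, v2}" "\<omega> \<in> cyl v" by (rule regionE)
    then have "flip j (fst (y j)) \<omega> \<in> cyl v \<inter> cyl w"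
      using n j t a by (auto simp: flip_cyl)
    then show "flip j (fst (y j)) \<omega> \<in> region (opp_meeting V i l w)"
      using f(7) v(1) regionI[of v "{v1, v2}"] by blast
  qed (use y opp_meeting_code(3) in \<open>auto simp: slice_def\<close>)
  with f(6) show False by simp
qed

text \<open>The letter \<open>w j\<close> is no constraint inside \<open>cyl w\<close>. If no word
  had it, the words with letter \<open>v1 j\<close> would form a cover of the trace of
  \<open>v1\<close> alone, which takes 5 words.\<close>

lemma opp_meeting_has_star: assumes w: "crossing V W i l w" shows "\<exists>y\<in>opp_meeting V i l w. y j = w j"
proof (rule ccontr)
  assume n: "\<not> ?thesis"
  note f = crossing_facts[OF w]
  let ?Q = "slice (opp_meeting V i l w) j (v1 j)"
  have sub: "?Q \<subseteq> opp_meeting V i l w" by (auto simp: slice_def)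
  have eq: "region {v1} \<inter> cyl w = region ?Q \<inter> cyl w"
  proof (intro equalityI subsetI IntI; elim IntE)
    fix \<omega> assume a: "\<omega> \<in> region {v1}" "\<omega> \<in> cyl w"
    then have v: "\<omega> \<in> cyl v1" by (simp add: region_def)
    then have "\<omega> \<in> region {v1, v2}" by (simp add: region_def)
    then have "\<omega> \<in> region (opp_meeting V i l w)" using f(7) a by blast
    then obtain y where y: "y \<in> opp_meeting V i l w" "\<omega> \<in> cyl y" by (rule regionE)
    have "fst (y j) = fst (v1 j)" using opp_meeting_letters[OF w y(1)] n y by blast
    then have "y j = v1 j" using cylD[OF v, of j] cylD[OF y(2), of j] by (simp add: prod_eq_iff)
    with y show "\<omega> \<in> region ?Q" by (auto simp: slice_def region_def)
  next
    fix \<omega> assume a: "\<omega> \<in> region ?Q" "\<omega> \<in> cyl w"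
    then have "\<omega> \<in> region (opp_meeting V i l w)" by (auto dest: region_sliceD)
    then have "\<omega> \<in> region {v1, v2}" using f(7) a by blast
    moreover have "\<omega> \<notin> cyl v2" using region_slice_bit[OF a(1)] cylD[of \<omega> v2 j] j by auto
    ultimately show "\<omega> \<in> region {v1}" by (auto simp: region_def)
  qed
  have "card ?Q \<ge> 5"
    by (rule equal_covers_card(2)[OF code_subset[OF opp_meeting_code(1) sub] twin_free_subset[OF opp_meeting_code(2) sub] _ _ _ _ eq])
      (use f(1) opp_meeting_code(3,5) sub in auto)
  moreover have "card ?Q \<le> card (opp_meeting V i l w)" using sub opp_meeting_code(4) by (rule card_mono[rotated])
  ultimately show False using f(6) by simp
qed

text \<open>Otherwise flipping the bit of \<open>v1 j\<close> preserves the trace, and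
  \<open>slice_cover_card\<close> demands 4 words of the pair.\<close>

lemma opp_meeting_has_type: assumes w: "crossing V W i l w" shows "\<exists>y\<in>opp_meeting V i l w. fst (y j) = fst (v1 j)"
proof (rule ccontr)
  assume n: "\<not> ?thesis"
  note f = crossing_facts[OF w]
  have "card {v1, v2} \<ge> 4"
  proof (rule slice_cover_card[where e = w and j = j and l = "v1 j", OF slice_pair_code(1,2) _ f(3)])
    fix \<omega> assume a: "\<omega> \<in> cyl w" "\<omega> \<in> region {v1, v2}"
    then have "\<omega> \<in> region (opp_meeting V i l w)" using f(7) by blast
    then obtain y where y: "y \<in> opp_meeting V i l w" "\<omega> \<in> cyl y" by (rule regionE)
    then have "flip j (fst (v1 j)) \<omega> \<in> cyl y \<inter> cyl w"
      using n f(3) a by (auto simp: flip_cyl)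
    then show "flip j (fst (v1 j)) \<omega> \<in> region {v1, v2}"
      using f(7) y(1) regionI[of y "opp_meeting V i l w"] by blast
  qed (use f in \<open>auto simp: slice_def\<close>)
  with slice_pair_code(3) show False by simp
qed

text \<open>On the side of \<open>v1\<close> at \<open>j\<close> only \<open>y\<close> is left, so
  the traces of \<open>v1\<close> and \<open>y\<close> agree there; comparing letters in both
  inclusions identifies the words off \<open>j\<close>.\<close>

lemma star_eq:
  assumes w: "crossing V W i l w" and y: "y \<in> opp_meeting V i l w" "y j = w j"
    and rest: "\<And>y'. y' \<in> opp_meeting V i l w \<Longrightarrow> y' \<noteq> y \<Longrightarrow> y' j = v2 j"
  shows "y = v1(j := w j)"
proof
  fix q
  note f = crossing_facts[OF w]
  have 1: "cyl v1 \<inter> cyl w \<subseteq> cyl y"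
  proof (intro subsetI; elim IntE)
    fix \<omega> assume a: "\<omega> \<in> cyl v1" "\<omega> \<in> cyl w"
    then have "\<omega> \<in> region {v1, v2}" by (simp add: region_def)
    then have "\<omega> \<in> region (opp_meeting V i l w)" using f(7) a by blast
    then obtain y' where y': "y' \<in> opp_meeting V i l w" "\<omega> \<in> cyl y'" by (rule regionE)
    have "y' j \<noteq> opp (v1 j)" using cylD[OF a(1), of j] cylD[OF y'(2), of j] by auto
    then have "y' = y" using rest[OF y'(1)] j by auto
    with y' show "\<omega> \<in> cyl y" by simp
  qed
  have 2: "cyl (y(j := v1 j)) \<inter> cyl w \<subseteq> cyl v1"
  proof (intro subsetI; elim IntE)
    fix \<omega> assume a: "\<omega> \<in> cyl (y(j := v1 j))" "\<omega> \<in> cyl w"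
    have "\<omega> \<in> cyl ((y(j := v1 j))(j := w j))"
      by (rule cyl_upd_cong[OF a(1)]) (use cylD[OF a(2), of j] in simp)
    then have "\<omega> \<in> cyl y" using y(2) by (simp add: fun_upd_idem)
    then have "\<omega> \<in> region (opp_meeting V i l w)" using y(1) regionI by blast
    then have "\<omega> \<in> region {v1, v2}" using f(7) a by blast
    moreover have "\<omega> \<notin> cyl v2" using cylD[OF a(1), of j] cylD[of \<omega> v2 j] j by auto
    ultimately show "\<omega> \<in> cyl v1" by (auto simp: region_def)
  qed
  have "\<not> clash (y(j := v1 j)) w"
    using opp_meeting_code(3)[OF y(1)] f(3) by (auto simp: clash_def same_type split: if_splits)
  from cyl_Int_subset[OF 1 f(1), of q] cyl_Int_subset[OF 2 this, of q]
  show "y q = (v1(j := w j)) q" using y(2) by (auto split: if_splits)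
qed

end

text \<open>Otherwise two distinct unconstrained words \<open>y\<close>, \<open>y'\<close> and one
  word \<open>z\<close> of the class of \<open>v1 j\<close> exhaust the opposite slice. By
  \<open>star_eq\<close>, \<open>y\<close> and \<open>y'\<close> come from one word by changing the
  letter at \<open>j\<close>, so they are twins.\<close>

lemma crossing_letter_unique:
  fixes V W :: "('n::finite \<Rightarrow> 'c letter) set"
  assumes R: "rival V W" and m: "mass V W i l \<le> 5"
    and A: "slice V i l = {v1, v2}" and D: "card (opp_slice V i l) \<le> 3" and j: "v2 j = opp (v1 j)"
    and w: "crossing V W i l w" "crossing V W i l w'"
  shows "w j = w' j"
proof (rule ccontr)
  assume n: "w j \<noteq> w' j"
  have A': "slice V i l = {v2, v1}" and j': "v1 j = opp (v2 j)" using A j by auto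
  have t: "fst (v2 j) = fst (v1 j)" using j by simp
  note f = crossing_facts[OF R m A D j]
  note star = opp_meeting_has_star[OF R m A D j] and type = opp_meeting_has_type[OF R m A D j]
    and letters = opp_meeting_letters[OF R m A D j]
  let ?M = "opp_meeting V i l"
  obtain y where y: "y \<in> ?M w" "y j = w j" using star[OF w(1)] by blast
  obtain y' where y': "y' \<in> ?M w'" "y' j = w' j" using star[OF w(2)] by blast
  obtain z where z: "z \<in> ?M w" "fst (z j) = fst (v1 j)" using type[OF w(1)] by blast
  have dist: "y \<noteq> y'" "y \<noteq> z" "y' \<noteq> z"
    using n y y' z f(3)[OF w(1)] f(3)[OF w(2)] by auto
  have sub: "?M w \<subseteq> opp_slice V i l" "?M w' \<subseteq> opp_slice V i l" by (auto simp: opp_meeting_def)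
  note c = rival_slices[OF R, of i l]
  have "{y, y', z} = opp_slice V i l"
    by (rule card_seteq) (use sub y y' z dist D finite_code[OF c(3)] in auto)
  then have all: "?M w \<subseteq> {y, y', z}" "?M w' \<subseteq> {y, y', z}" using sub by auto
  have "y' \<notin> ?M w" using letters[OF w(1), of y'] n y' f(3)[OF w(2)] by auto
  moreover have "y \<notin> ?M w'" using letters[OF w(2), of y] n y f(3)[OF w(1)] by auto
  ultimately have M: "?M w \<subseteq> {y, z}" "?M w' \<subseteq> {y', z}" using all by auto
  have twin: "False" if "y = v(j := w j)" "y' = v(j := w' j)" for v
  proof -
    have "y \<in> opp_slice V i l" "y' \<in> opp_slice V i l" using sub y y' by auto
    then have "clash y y'" using c(3) dist by (auto simp: code_def)
    then obtain q where q: "y' q = opp (y q)" by (auto simp: clash_def)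
    then have "q = j" using that by (auto split: if_splits)
    with q that have "y' = y(j := opp (y j))" by (auto simp: fun_eq_iff)
    then show False using c(7) \<open>y \<in> opp_slice V i l\<close> \<open>y' \<in> opp_slice V i l\<close>
      by (auto simp: twin_free_def)
  qed
  have "z j = v1 j \<or> z j = v2 j" using z(2) j by (simp add: same_type)
  then show False
  proof
    assume zj: "z j = v2 j"
    have "y = v1(j := w j)" by (rule star_eq[OF R m A D j w(1) y]) (use M zj in auto)
    moreover have "y' = v1(j := w' j)" by (rule star_eq[OF R m A D j w(2) y']) (use M zj in auto)
    ultimately show False by (rule twin)
  next
    assume zj: "z j = v1 j"
    have "y = v2(j := w j)" by (rule star_eq[OF R m A' D j' w(1) y]) (use M zj in auto)
    moreover have "y' = v2(j := w' j)" by (rule star_eq[OF R m A' D j' w(2) y']) (use M zj in auto)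
    ultimately show False by (rule twin)
  qed
qed

text \<open>A point of \<open>cyl v\<close> outside \<open>slice W i l\<close> lies in a crossing
  word, which prescribes \<open>b\<close> at \<open>p\<close>.\<close>

lemma half_subset_region_slice:
  assumes R: "rival V W" and v: "v \<in> slice V i l"
    and w: "\<And>w. crossing V W i l w \<Longrightarrow> w p = b"
  shows "cyl v \<inter> cyl (v(p := opp b)) \<subseteq> region (slice W i l)"
proof (intro subsetI; elim IntE; rule ccontr)
  fix \<omega> assume a: "\<omega> \<in> cyl v" "\<omega> \<in> cyl (v(p := opp b))" "\<omega> \<notin> region (slice W i l)"
  then have "\<omega> \<in> region (slice V i l)" using v regionI by blast
  from cover_outside_slice[OF R this a(3)] obtain w
    where c: "w \<in> W" "fst (w i) \<noteq> fst l" "\<omega> \<in> cyl w" by blast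
  then have "crossing V W i l w" using v clash_eqI[OF a(1) c(3)] by (auto simp: crossing_def)
  then have "w p = b" by (rule w)
  then show False using cylD[OF c(3), of p] cylD[OF a(2), of p] by simp
qed

text \<open>Crossing words have fixed letters at \<open>j\<close> and at some \<open>p\<close>, so
  the at most 3 words of \<open>slice W i l\<close> cover two halves of \<open>cyl v1\<close>. A
  word of that slice with the class of \<open>w0 j\<close> at \<open>j\<close> could be spared in
  one of them, against \<open>half_cover\<close>; so none has it, and a word of the slice overlaps
  \<open>w0\<close>.\<close>

lemma pair_pair_impossible:
  fixes V W :: "('n::finite \<Rightarrow> 'c letter) set"
  assumes R: "rival V W" and m: "mass V W i l \<le> 5" and near: "\<And>v w. v \<in> V \<Longrightarrow> w \<in> W \<Longrightarrow> \<not> near v w"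
    and A: "slice V i l = {v1, v2}" and j: "v2 j = opp (v1 j)"
    and C: "card (slice W i l) \<le> 3" and D: "opp_slice V i l = {y, z}" "y \<noteq> z"
    and w0: "crossing V W i l w0" and y: "y j = w0 j" and z: "z j = v2 j"
  shows False
proof -
  have D3: "card (opp_slice V i l) \<le> 3" using D by simp
  note c = rival_slices[OF R, of i l]
  note f = crossing_facts[OF R m A D3 j]
  let ?M = "opp_meeting V i l" and ?C = "slice W i l" and ?b = "w0 j"
  have beta: "w j = ?b" if "crossing V W i l w" for w
    by (rule crossing_letter_unique[OF R m A D3 j that w0])
  have M: "?M w = {y, z}" if "crossing V W i l w" for w
  proof (rule card_seteq)
    show "?M w \<subseteq> {y, z}" using D by (auto simp: opp_meeting_def)
    show "card {y, z} \<le> card (?M w)" using f(5)[OF that] D(2) by simp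
  qed simp
  have nc: "\<not> clash y w" "\<not> clash z w" if "crossing V W i l w" for w
    using opp_meeting_code(3)[OF R m A D3 j, of _ w] M[OF that] by auto
  have y1: "y = v1(j := ?b)"
    by (rule star_eq[OF R m A D3 j w0]) (use M[OF w0] y z in auto)
  have "clash y z" using c(3) D by (auto simp: code_def)
  then obtain p where p: "z p = opp (y p)" by (auto simp: clash_def)
  have fb: "fst ?b \<noteq> fst (v1 j)" by (rule f(3)[OF w0])
  have pj: "p \<noteq> j" using p y z j fb by (auto simp: same_type)
  \<comment> \<open>\<open>y\<close> and \<open>z\<close> meet \<open>w\<close> but are opposite at
    \<open>p\<close>. On the side of \<open>v2\<close> at \<open>j\<close> their traces lie in
    \<open>cyl v2\<close>, so \<open>v2 p\<close> is \<open>w p\<close> or else both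
    \<open>y p\<close> and \<open>z p\<close>.\<close>
  have zeta: "fst (w p) \<noteq> fst (y p)" "w p = v2 p" if w: "crossing V W i l w" for w
  proof -
    have "w p \<noteq> opp (y p)" "w p \<noteq> opp (z p)" using nc[OF w] by (auto simp: clash_def)
    then show t: "fst (w p) \<noteq> fst (y p)" using p by (auto simp: same_type)
    have reg: "\<omega> \<in> cyl v2" if "\<omega> \<in> cyl w" "u \<in> {y, z}" "\<omega> \<in> cyl u" "\<omega> j (fst (v2 j)) = snd (v2 j)" for \<omega> u
    proof -
      have "\<omega> \<in> region (?M w)" using M[OF w] that(2,3) regionI by blast
      then have "\<omega> \<in> region {v1, v2}" using f(7)[OF w] that(1) by blast
      moreover have "\<omega> \<notin> cyl v1" using that(4) cylD[of \<omega> v1 j] j by auto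
      ultimately show ?thesis by (auto simp: region_def)
    qed
    have 1: "cyl z \<inter> cyl w \<subseteq> cyl v2"
      using reg[of _ z] cylD[of _ z j] z by auto
    have 2: "cyl (y(j := v2 j)) \<inter> cyl w \<subseteq> cyl v2"
    proof (intro subsetI; elim IntE)
      fix \<omega> assume a: "\<omega> \<in> cyl (y(j := v2 j))" "\<omega> \<in> cyl w"
      have "\<omega> \<in> cyl ((y(j := v2 j))(j := w j))"
        by (rule cyl_upd_cong[OF a(1)]) (use cylD[OF a(2), of j] in simp)
      then have "\<omega> \<in> cyl y" using beta[OF w] y by (simp add: fun_upd_idem)
      then show "\<omega> \<in> cyl v2" using reg[OF a(2), of y] cylD[OF a(1), of j] by simp
    qed
    have "\<not> clash (y(j := v2 j)) w"
      using nc(1)[OF w] f(4)[OF w] by (auto simp: clash_def same_type split: if_splits)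
    from cyl_Int_subset[OF 1 nc(2)[OF w], of p] cyl_Int_subset[OF 2 this, of p]
    show "w p = v2 p" using p pj by (auto split: if_splits)
  qed
  define x where "x = v2 p"
  have v1: "v1 \<in> slice V i l" using A by simp
  have V1: "v1 \<in> V" using v1 by (simp add: slice_def)
  have e1: "cyl v1 \<inter> cyl (v1(j := opp ?b)) \<subseteq> region ?C"
    by (rule half_subset_region_slice[OF R v1 beta])
  have e2: "cyl v1 \<inter> cyl (v1(p := opp x)) \<subseteq> region ?C"
    by (rule half_subset_region_slice[OF R v1]) (simp add: zeta(2) x_def)
  have xt: "fst (opp x) \<noteq> fst (v1 p)"
    using zeta[OF w0] y1 pj by (simp add: x_def)
  have smaller: "card (?C - {u}) \<le> 2" if "u \<in> ?C" for u
    using that C by simp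
  have CW: "u \<in> W" if "u \<in> ?C" for u using that by (simp add: slice_def)
  \<comment> \<open>Such a \<open>u\<close> misses the half at \<open>j\<close>, so two words would
    cover it.\<close>
  have notb: "u j \<noteq> ?b" if u: "u \<in> ?C" for u
  proof
    assume uj: "u j = ?b"
    show False
    proof (rule half_cover[where v = v1 and j = j and b = "opp ?b" and C = "?C - {u}"])
      show "cyl v1 \<inter> cyl (v1(j := opp ?b)) \<subseteq> region (?C - {u})"
      proof (intro subsetI; elim IntE)
        fix \<omega> assume a: "\<omega> \<in> cyl v1" "\<omega> \<in> cyl (v1(j := opp ?b))"
        then have "\<omega> \<in> region ?C" using e1 by blast
        then obtain c' where c': "c' \<in> ?C" "\<omega> \<in> cyl c'" by (rule regionE)
        have "c' \<noteq> u" using uj cylD[OF c'(2), of j] cylD[OF a(2), of j] by auto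
        with c' show "\<omega> \<in> region (?C - {u})" by (auto simp: region_def)
      qed
      show "\<not> near v1 c'" if "c' \<in> ?C - {u}" for c' using near[OF V1] CW that by simp
    qed (use smaller[OF u] fb in \<open>auto intro: code_subset[OF c(2)] twin_free_subset[OF c(6)]\<close>)
  qed
  \<comment> \<open>In the half at \<open>p\<close>, setting the bit of \<open>?b\<close> leads to a
    point outside \<open>u\<close>. Its covering word has another class at \<open>j\<close>, hence
    covers the original point too, and \<open>u\<close> can be spared.\<close>
  have notb': "u j \<noteq> opp ?b" if u: "u \<in> ?C" for u
  proof
    assume uj: "u j = opp ?b"
    show False
    proof (rule half_cover[where v = v1 and j = p and b = "opp x" and C = "?C - {u}"])
      show "cyl v1 \<inter> cyl (v1(p := opp x)) \<subseteq> region (?C - {u})"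
      proof (intro subsetI; elim IntE)
        fix \<omega> assume a: "\<omega> \<in> cyl v1" "\<omega> \<in> cyl (v1(p := opp x))"
        define \<rho> where "\<rho> = (if \<omega> j (fst ?b) = snd ?b then \<omega> else flip j (fst ?b) \<omega>)"
        have "\<rho> \<in> cyl v1" "\<rho> \<in> cyl (v1(p := opp x))"
          using a fb pj by (auto simp: \<rho>_def flip_cyl)
        then have "\<rho> \<in> region ?C" using e2 by blast
        then obtain c' where c': "c' \<in> ?C" "\<rho> \<in> cyl c'" by (rule regionE)
        have "\<rho> j (fst ?b) = snd ?b" by (auto simp: \<rho>_def flip_def)
        then have "c' j \<noteq> opp ?b" using cylD[OF c'(2), of j] by auto
        then have "c' \<noteq> u" "fst (c' j) \<noteq> fst ?b" using uj notb[OF c'(1)] by (auto simp: same_type)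
        then have "\<omega> \<in> cyl c'" using c'(2) by (auto simp: \<rho>_def flip_cyl split: if_splits)
        with c' \<open>c' \<noteq> u\<close> show "\<omega> \<in> region (?C - {u})" by (auto simp: region_def)
      qed
      show "\<not> near v1 c'" if "c' \<in> ?C - {u}" for c' using near[OF V1] CW that by simp
    qed (use smaller[OF u] xt in \<open>auto intro: code_subset[OF c(2)] twin_free_subset[OF c(6)]\<close>)
  qed
  \<comment> \<open>Flipped into the half at \<open>j\<close>, the point is covered by some
    \<open>u\<close> that ignores the flipped bit. So \<open>u\<close> is \<open>w0\<close>,
    although \<open>w0\<close> has another class at \<open>i\<close>.\<close>
  obtain \<omega> where w: "\<omega> \<in> cyl v1" "\<omega> \<in> cyl w0" using f(1)[OF w0] not_clash_point by blast
  have "flip j (fst ?b) \<omega> \<in> cyl v1" using w fb by (simp add: flip_cyl)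
  moreover from this have "flip j (fst ?b) \<omega> \<in> cyl (v1(j := opp ?b))"
    by (rule cyl_upd_cong) (use cylD[OF w(2), of j] in \<open>simp add: flip_def\<close>)
  ultimately have "flip j (fst ?b) \<omega> \<in> region ?C" using e1 by blast
  then obtain u where u: "u \<in> ?C" "flip j (fst ?b) \<omega> \<in> cyl u" by (rule regionE)
  have "fst (u j) \<noteq> fst ?b" using notb[OF u(1)] notb'[OF u(1)] by (simp add: same_type)
  then have "\<omega> \<in> cyl u" using u(2) by (simp add: flip_cyl)
  moreover have "code W" using R by (simp add: rival_def)
  ultimately have "u = w0" using code_eqI[of W u w0 \<omega>] w CW[OF u(1)] w0 by (simp add: crossing_def)
  with u(1) w0 show False by (auto simp: crossing_def slice_def)
qed

text \<open>The sizes of \<open>slice W i l\<close> and \<open>opp_slice V i l\<close> are at least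
  2 with sum at most 5. If the former is 2, \<open>half_cover\<close> applies at once; otherwise
  they are 3 and 2.\<close>

lemma small_mass_pair_impossible:
  fixes V W :: "('n::finite \<Rightarrow> 'c letter) set"
  assumes R: "rival V W" and m: "mass V W i l \<le> 5" and near: "\<And>v w. v \<in> V \<Longrightarrow> w \<in> W \<Longrightarrow> \<not> near v w"
    and A2: "card (slice V i l) = 2"
  shows False
proof -
  obtain v1 v2 where A: "slice V i l = {v1, v2}" "v1 \<noteq> v2" using A2 by (auto simp: card_2_iff)
  have v: "v1 \<in> V \<union> W" "fst (v1 i) = fst l" using A by (auto simp: slice_def)
  note c = rival_slices[OF R, of i l]
  have m': "mass W V i l \<le> 5" using m mass_swap[OF R, of i l] by simp
  have cd: "card (slice W i l) + card (opp_slice V i l) \<le> 5" using m' by (simp add: mass_alt)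
  have C2: "card (slice W i l) \<ge> 2"
    using slices_ge_2(1)[OF rival_sym[OF R] m', of v1] v by blast
  have D2: "card (opp_slice V i l) \<ge> 2" using slices_ge_2(2)[OF R m v] .
  have D3: "card (opp_slice V i l) \<le> 3" using cd C2 by linarith
  have "clash v1 v2" using c(1) A by (auto simp: code_def)
  then obtain j where j: "v2 j = opp (v1 j)" by (auto simp: clash_def)
  obtain w0 where "w0 \<in> W" "fst (w0 i) \<noteq> fst l" "{a \<in> slice V i l. \<not> clash a w0} \<noteq> {}"
    using crossing_exists[OF R m v] by blast
  then have w0: "crossing V W i l w0" by (auto simp: crossing_def)
  note f = crossing_facts[OF R m A(1) D3 j]
  show False
  proof (cases "card (slice W i l) \<le> 2")
    case True
    have "cyl v1 \<inter> cyl (v1(j := opp (w0 j))) \<subseteq> region (slice W i l)"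
      by (rule half_subset_region_slice[OF R]) (use A crossing_letter_unique[OF R m A(1) D3 j _ w0] in auto)
    moreover have "\<not> near v1 u" if "u \<in> slice W i l" for u
      using near[of v1 u] A that by (auto simp: slice_def)
    ultimately show False
      using half_cover[OF c(2,6) True, of "opp (w0 j)" v1 j] f(3)[OF w0] by simp
  next
    case False
    then have C3: "card (slice W i l) \<le> 3" and D: "card (opp_slice V i l) = 2" using cd D2 by linarith+
    obtain y where y: "y \<in> opp_meeting V i l w0" "y j = w0 j"
      using opp_meeting_has_star[OF R m A(1) D3 j w0] by blast
    obtain z where z: "z \<in> opp_meeting V i l w0" "fst (z j) = fst (v1 j)"
      using opp_meeting_has_type[OF R m A(1) D3 j w0] by blast
    have yz: "y \<noteq> z" using y z f(3)[OF w0] by auto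
    have "{y, z} = opp_slice V i l"
      by (rule card_seteq) (use y z yz D finite_code[OF c(3)] in \<open>auto simp: opp_meeting_def\<close>)
    then have Dyz: "opp_slice V i l = {y, z}" by simp
    have "z j = v1 j \<or> z j = v2 j" using z(2) j by (simp add: same_type)
    then show False
    proof
      assume "z j = v2 j"
      then show False using pair_pair_impossible[OF R m near A(1) j C3 Dyz yz w0 y(2)] by blast
    next
      assume "z j = v1 j"
      moreover have "slice V i l = {v2, v1}" "v1 j = opp (v2 j)" using A j by auto
      ultimately show False
        using pair_pair_impossible[OF R m near _ _ C3 Dyz yz w0 y(2)] by blast
    qed
  qed
qed

text \<open>For mass at most 5, two sizes of at least 2 cannot both be 3; exchanging
  \<open>V\<close> with \<open>W\<close> and \<open>l\<close> with \<open>opp l\<close> relates the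
  two cases.\<close>

lemma mass_ge_6:
  fixes V W :: "('n::finite \<Rightarrow> 'c letter) set"
  assumes R: "rival V W" and near: "\<And>v w. v \<in> V \<Longrightarrow> w \<in> W \<Longrightarrow> \<not> near v w"
    and v: "v \<in> V \<union> W" "fst (v i) = fst l"
  shows "mass V W i l \<ge> 6"
proof (rule ccontr)
  assume "\<not> ?thesis"
  then have m: "mass V W i l \<le> 5" by simp
  have m': "mass W V i (opp l) \<le> 5" "mass W V i l \<le> 5"
    using m mass_swap[OF R, of i l] mass_opp[of W V i l] by simp_all
  have "card (slice V i l) \<ge> 2" using slices_ge_2(1)[OF R m v] .
  moreover have "card (opp_slice W i l) \<ge> 2"
    using slices_ge_2(2)[OF rival_sym[OF R] m'(2), of v] v by blast
  ultimately consider "card (slice V i l) = 2" | "card (slice W i (opp l)) = 2"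
    using m by (fastforce simp: mass_alt card_opp_slice)
  then show False
  proof cases
    case 1
    with R m near show False by (rule small_mass_pair_impossible)
  next
    case 2
    have "\<not> near w u" if "w \<in> W" "u \<in> V" for w u using near that near_sym by blast
    with rival_sym[OF R] m'(1) show False using 2 by (rule small_mass_pair_impossible)
  qed
qed

text \<open>Two classes of mass at least 6 at one coordinate contain at least 24 words of
  \<open>V\<close> and \<open>W\<close> together, and \<open>V\<close> and \<open>W\<close> have
  equally many words. Such classes come from a near pair, or else from any meeting pair.\<close>

lemma rival_card:
  fixes V W :: "('n::finite \<Rightarrow> 'c letter) set"
  assumes R: "rival V W" and ne: "V \<noteq> {}"
  shows "card V \<ge> 12"
proof -
  have r: "code V" "code W" "V \<inter> W = {}" "region V = region W" using R by (auto simp: rival_def)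
  have fin: "finite V" "finite W" using r finite_code by auto
  obtain v w i where vw: "v \<in> V" "w \<in> W" "\<not> clash v w" "v i \<noteq> w i"
    and m: "mass V W i (v i) \<ge> 6" "mass V W i (w i) \<ge> 6"
  proof (cases "\<exists>v\<in>V. \<exists>w\<in>W. near v w")
    case True
    then obtain v w j z where vw: "v \<in> V" "w \<in> W" "\<not> clash v w" "w = v(j := z)"
      unfolding near_def by blast
    have wv: "v = w(j := v j)" "\<not> clash w v" using vw clash_sym by auto
    have "v j \<noteq> w j" using wv(1) vw r(3) by auto
    moreover have "mass V W j (v j) \<ge> 6" by (rule near_mass[OF R vw])
    moreover have "mass V W j (w j) \<ge> 6"
      using near_mass[OF rival_sym[OF R] vw(2,1) wv(2,1)] mass_swap[OF R, of j "w j"] by simp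
    ultimately show thesis using that vw by blast
  next
    case False
    obtain v where v: "v \<in> V" using ne by blast
    obtain \<omega> where w: "\<omega> \<in> cyl v" using cyl_nonempty by blast
    then have "\<omega> \<in> region W" using v r(4) regionI by blast
    then obtain w where ww: "w \<in> W" "\<omega> \<in> cyl w" by (rule regionE)
    have "v \<noteq> w" using v ww r(3) by auto
    then obtain i where i: "v i \<noteq> w i" by auto
    have near: "\<not> near v w" if "v \<in> V" "w \<in> W" for v w using False that by blast
    have "mass V W i (v i) \<ge> 6" by (rule mass_ge_6[OF R near, where v = v]) (use v in auto)
    moreover have "mass V W i (w i) \<ge> 6" by (rule mass_ge_6[OF R near, where v = w]) (use ww in auto)
    ultimately show thesis by (rule that[OF v ww(1) clash_eqI[OF w ww(2)] i])
  qed
  have t: "fst (v i) \<noteq> fst (w i)" using vw(3,4) by (auto simp: clash_def same_type dest!: spec[of _ i])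
  let ?T = "\<lambda>V l. {u \<in> V. fst (u i) = fst l}"
  have "card (?T V l) + card (?T W l) = 2 * mass V W i l" for l
    using slices_card[OF fin(1), of i l] slices_card[OF fin(2), of i l] mass_swap[OF R, of i l]
    by (simp add: mass_def)
  from this[of "v i"] this[of "w i"] m
  have "24 \<le> card (?T V (v i)) + card (?T V (w i)) + (card (?T W (v i)) + card (?T W (w i)))"
    by linarith
  moreover have "card (?T U (v i)) + card (?T U (w i)) \<le> card U" if "finite U" for U :: "('n \<Rightarrow> 'c letter) set"
  proof -
    have "card (?T U (v i) \<union> ?T U (w i)) = card (?T U (v i)) + card (?T U (w i))"
      by (rule card_Un_disjoint) (use that t in auto)
    moreover have "card (?T U (v i) \<union> ?T U (w i)) \<le> card U" by (rule card_mono) (use that in auto)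
    ultimately show ?thesis by simp
  qed
  ultimately have "24 \<le> card V + card W" using fin by (meson add_mono order_trans)
  moreover have "card V = card W" using card_code(1)[OF r(1)] card_code(1)[OF r(2)] r(4) by simp
  ultimately show ?thesis by simp
qed

section \<open>Shifting cubes of a tiling\<close>

definition covers :: "real ^ 'n \<Rightarrow> real ^ 'n \<Rightarrow> bool" where
  "covers t y \<longleftrightarrow> (\<forall>i. t $ i \<le> y $ i \<and> y $ i < t $ i + 1)"

text \<open>Positions \<open>f t\<close> are separated from names \<open>t\<close>, so that a
  shifted cube keeps its name.\<close>

definition tiles :: "('a \<Rightarrow> real ^ 'n) \<Rightarrow> 'a set \<Rightarrow> bool" where
  "tiles f T \<longleftrightarrow> (\<forall>y. \<exists>!t. t \<in> T \<and> covers (f t) y)"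

definition upd :: "real ^ 'n \<Rightarrow> 'n \<Rightarrow> real \<Rightarrow> real ^ 'n" where
  "upd y j r = (\<chi> i. if i = j then r else y $ i)"

lemma upd_nth [simp]: "upd y j r $ i = (if i = j then r else y $ i)"
  by (simp add: upd_def)

lemma mem_translate_half_open_cube: "y \<in> translate half_open_cube t \<longleftrightarrow> covers t y"
proof -
  have "y \<in> translate half_open_cube t \<longleftrightarrow> y - t \<in> half_open_cube"
    unfolding translate_def by (metis (no_types, lifting) add_diff_cancel diff_add_cancel image_iff)
  then show ?thesis by (auto simp: half_open_cube_def covers_def algebra_simps)
qed

lemma mem_translate_closed_cube:
  "y \<in> translate closed_cube x \<longleftrightarrow> (\<forall>i. x $ i \<le> y $ i \<and> y $ i \<le> x $ i + 1)"
proof -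
  have "y \<in> translate closed_cube x \<longleftrightarrow> y - x \<in> closed_cube"
    unfolding translate_def by (metis (no_types, lifting) add_diff_cancel diff_add_cancel image_iff)
  then show ?thesis by (auto simp: closed_cube_def algebra_simps)
qed

lemma cube_tiling_tiles: "cube_tiling T \<Longrightarrow> tiles id T"
  unfolding cube_tiling_def tiles_def disjoint_family_on_def
proof (intro allI)
  fix y assume a: "(\<forall>m\<in>T. \<forall>n\<in>T. m \<noteq> n \<longrightarrow> translate half_open_cube m \<inter> translate half_open_cube n = {})
    \<and> \<Union> (translate half_open_cube ` T) = UNIV"
  then have "y \<in> \<Union> (translate half_open_cube ` T)" by blast
  then obtain t where t: "t \<in> T" "y \<in> translate half_open_cube t" by blast
  show "\<exists>!t. t \<in> T \<and> covers (id t) y"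
  proof (rule ex1I[of _ t])
    show "t \<in> T \<and> covers (id t) y" using t by (simp add: mem_translate_half_open_cube)
    fix s assume "s \<in> T \<and> covers (id s) y"
    then show "s = t" using a t by (auto simp: mem_translate_half_open_cube[symmetric])
  qed
qed

lemma closed_cube_meets:
  "translate half_open_cube t \<inter> translate closed_cube x \<noteq> {} \<longleftrightarrow>
    (\<forall>i. x $ i - 1 < t $ i \<and> t $ i \<le> x $ i + 1)"
proof
  assume "translate half_open_cube t \<inter> translate closed_cube x \<noteq> {}"
  then obtain y where y: "covers t y" "\<forall>i. x $ i \<le> y $ i \<and> y $ i \<le> x $ i + 1"
    by (auto simp: mem_translate_half_open_cube mem_translate_closed_cube)
  show "\<forall>i. x $ i - 1 < t $ i \<and> t $ i \<le> x $ i + 1"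
  proof
    fix i
    show "x $ i - 1 < t $ i \<and> t $ i \<le> x $ i + 1"
      using y(1)[unfolded covers_def, rule_format, of i] y(2)[rule_format, of i] by linarith
  qed
next
  assume a: "\<forall>i. x $ i - 1 < t $ i \<and> t $ i \<le> x $ i + 1"
  have "(\<chi> i. max (t $ i) (x $ i)) \<in> translate half_open_cube t \<inter> translate closed_cube x"
    unfolding Int_iff mem_translate_half_open_cube mem_translate_closed_cube covers_def vec_lambda_beta
  proof (intro conjI allI)
    fix i
    note a[rule_format, of i]
    then show "t $ i \<le> max (t $ i) (x $ i)" "max (t $ i) (x $ i) < t $ i + 1"
      "x $ i \<le> max (t $ i) (x $ i)" "max (t $ i) (x $ i) \<le> x $ i + 1" by auto
  qed
  then show "translate half_open_cube t \<inter> translate closed_cube x \<noteq> {}" by blast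
qed

lemma tilesE:
  assumes "tiles f T" obtains t where "t \<in> T" "covers (f t) y"
  using assms unfolding tiles_def by blast

lemma tiles_unique: "tiles f T \<Longrightarrow> t \<in> T \<Longrightarrow> s \<in> T \<Longrightarrow> covers (f t) y \<Longrightarrow> covers (f s) y \<Longrightarrow> t = s"
  unfolding tiles_def by blast

lemma covers_updD: "covers u (upd y j r) \<Longrightarrow> u $ j \<le> r \<and> r < u $ j + 1"
  unfolding covers_def by (metis upd_nth)

lemma covers_upd_upd: "covers u (upd y j r) \<Longrightarrow> u $ j \<le> s \<Longrightarrow> s < u $ j + 1 \<Longrightarrow> covers u (upd y j s)"
  unfolding covers_def by (metis upd_nth)

text \<open>A cube starting earlier would overlap \<open>t\<close> at the larger of the two starting
  points.\<close>

lemma line_next: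
  assumes T: "tiles f T" and t: "t \<in> T" "covers (f t) (upd y j r)"
    and s: "s \<in> T" "covers (f s) (upd y j (f t $ j + 1))"
  shows "f s $ j = f t $ j + 1"
proof (rule ccontr)
  assume n: "f s $ j \<noteq> f t $ j + 1"
  note bs = covers_updD[OF s(2)]
  have lt: "f s $ j < f t $ j + 1" using bs n by linarith
  let ?r = "max (f s $ j) (f t $ j)"
  have "covers (f s) (upd y j ?r)" by (rule covers_upd_upd[OF s(2)]) (use bs in auto)
  moreover have "covers (f t) (upd y j ?r)" by (rule covers_upd_upd[OF t(2)]) (use lt in auto)
  ultimately have "s = t" using tiles_unique[OF T s(1) t(1)] by blast
  with bs show False by simp
qed

text \<open>Otherwise the successor of \<open>s\<close>, given by \<open>line_next\<close>, would
  contain the starting point of \<open>t\<close> without being \<open>t\<close>.\<close>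

lemma line_prev:
  assumes T: "tiles f T" and t: "t \<in> T" "covers (f t) (upd y j r)"
    and s: "s \<in> T" "covers (f s) (upd y j (f t $ j - 1))"
  shows "f s $ j = f t $ j - 1"
proof (rule ccontr)
  assume n: "f s $ j \<noteq> f t $ j - 1"
  note bs = covers_updD[OF s(2)]
  obtain u where u: "u \<in> T" "covers (f u) (upd y j (f s $ j + 1))" using tilesE[OF T] by blast
  have fu: "f u $ j = f s $ j + 1" by (rule line_next[OF T s u])
  have "covers (f u) (upd y j (f t $ j))"
    by (rule covers_upd_upd[OF u(2)]) (use fu bs n in linarith)+
  moreover have "covers (f t) (upd y j (f t $ j))" by (rule covers_upd_upd[OF t(2)]) auto
  ultimately have "u = t" using tiles_unique[OF T u(1) t(1)] by blast
  with fu n show False by simp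
qed

lemma line_class:
  assumes T: "tiles f T" and t: "t \<in> T" "covers (f t) (upd y j r)"
  shows "\<exists>u\<in>T. covers (f u) (upd y j (f t $ j + of_int k)) \<and> f u $ j = f t $ j + of_int k"
proof (induction k rule: int_induct[where k = 0])
  case base
  have "covers (f t) (upd y j (f t $ j))" by (rule covers_upd_upd[OF t(2)]) auto
  then show ?case using t(1) by auto
next
  case (step1 i)
  then obtain u where u: "u \<in> T" "covers (f u) (upd y j (f t $ j + of_int i))"
    "f u $ j = f t $ j + of_int i" by blast
  obtain s where s: "s \<in> T" "covers (f s) (upd y j (f u $ j + 1))" using tilesE[OF T] by blast
  have "f s $ j = f u $ j + 1" by (rule line_next[OF T u(1,2) s])
  with s u show ?case by (auto simp: algebra_simps)
next
  case (step2 i)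
  then obtain u where u: "u \<in> T" "covers (f u) (upd y j (f t $ j + of_int i))"
    "f u $ j = f t $ j + of_int i" by blast
  obtain s where s: "s \<in> T" "covers (f s) (upd y j (f u $ j - 1))" using tilesE[OF T] by blast
  have "f s $ j = f u $ j - 1" by (rule line_prev[OF T u(1,2) s])
  with s u show ?case by (auto simp: algebra_simps)
qed

text \<open>By \<open>line_class\<close>, the cubes at integer distances from \<open>t\<close> fill
  the line already.\<close>

lemma line_congruent:
  assumes T: "tiles f T" and t: "t \<in> T" "covers (f t) (upd y j r)"
    and s: "s \<in> T" "covers (f s) (upd y j r')"
  shows "\<exists>k. f s $ j = f t $ j + of_int k"
proof -
  let ?k = "\<lfloor>r' - f t $ j\<rfloor>"
  obtain u where u: "u \<in> T" "covers (f u) (upd y j (f t $ j + of_int ?k))"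
    "f u $ j = f t $ j + of_int ?k" using line_class[OF T t] by blast
  have "covers (f u) (upd y j r')"
    by (rule covers_upd_upd[OF u(2)]) (use u(3) in linarith)+
  then have "u = s" using tiles_unique[OF T u(1) s(1)] s(2) by blast
  with u(3) show ?thesis by blast
qed

text \<open>By \<open>line_congruent\<close>, a periodic \<open>h\<close> moves all cubes on a line
  parallel to axis \<open>j\<close> by the same amount.\<close>

lemma tiles_shift:
  assumes T: "tiles f T" and h: "\<And>r k. h (r + of_int k) = h r"
  shows "tiles (\<lambda>t. upd (f t) j (f t $ j + h (f t $ j))) T"
proof -
  let ?g = "\<lambda>t. upd (f t) j (f t $ j + h (f t $ j))"
  have g: "covers (?g t) y \<longleftrightarrow> covers (f t) (upd y j (y $ j - h (f t $ j)))" for t y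
    unfolding covers_def by (rule iff_allI) auto
  have cong: "h (f t $ j) = h (f s $ j)" if "t \<in> T" "s \<in> T" "covers (f t) (upd y j r)" "covers (f s) (upd y j r')" for t s y r r'
    using line_congruent[OF T that(1,3,2,4)] h by metis
  show ?thesis
    unfolding tiles_def
  proof
    fix y
    obtain t0 where t0: "t0 \<in> T" "covers (f t0) (upd y j (y $ j))" using tilesE[OF T] by blast
    obtain t where t: "t \<in> T" "covers (f t) (upd y j (y $ j - h (f t0 $ j)))" using tilesE[OF T] by blast
    have "covers (?g t) y" unfolding g using cong[OF t(1) t0(1) t(2) t0(2)] t by simp
    moreover have "s = t" if "s \<in> T" "covers (?g s) y" for s
    proof -
      have c: "covers (f s) (upd y j (y $ j - h (f s $ j)))" using that g by blast
      have "h (f s $ j) = h (f t0 $ j)" by (rule cong[OF that(1) t0(1) c t0(2)])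
      with c t that(1) tiles_unique[OF T that(1) t(1)] show ?thesis by simp
    qed
    ultimately show "\<exists>!t. t \<in> T \<and> covers (?g t) y" using t(1) by blast
  qed
qed

lemma tiles_shift_all:
  fixes T :: "(real ^ 'n) set"
  assumes T: "tiles id T" and h: "\<And>i r k. h i (r + of_int k) = h i r"
  shows "tiles (\<lambda>t. \<chi> i. t $ i + h i (t $ i)) T"
proof -
  have "tiles (\<lambda>t. \<chi> i. t $ i + (if i \<in> J then h i (t $ i) else 0)) T" for J :: "'n set"
    using finite[of J]
  proof (induction J)
    case empty
    then show ?case using T by (simp add: vec_eq_iff id_def)
  next
    case (insert j J)
    let ?f = "\<lambda>t. \<chi> i. t $ i + (if i \<in> J then h i (t $ i) else 0)"
    have "tiles (\<lambda>t. upd (?f t) j (?f t $ j + h j (?f t $ j))) T"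
      by (rule tiles_shift[OF insert.IH h])
    moreover have "upd (?f t) j (?f t $ j + h j (?f t $ j)) =
        (\<chi> i. t $ i + (if i \<in> insert j J then h i (t $ i) else 0))" for t :: "real ^ 'n"
      using insert.hyps by (auto simp: vec_eq_iff)
    ultimately show ?case by simp
  qed
  from this[of UNIV] show ?thesis by simp
qed

section \<open>The words of a tiling at a point\<close>

text \<open>For a cube meeting the closed cube at \<open>x\<close>, the class is named by its
  representative above \<open>x $ i - 1\<close> and at most \<open>x $ i\<close>.\<close>

definition word :: "real ^ 'n \<Rightarrow> real ^ 'n \<Rightarrow> 'n \<Rightarrow> real letter" where
  "word x t i = (if t $ i \<le> x $ i then (t $ i, False) else (t $ i - 1, True))"

definition local_words :: "(real ^ 'n) set \<Rightarrow> real ^ 'n \<Rightarrow> ('n \<Rightarrow> real letter) set" where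
  "local_words T x = word x ` {t \<in> T. \<forall>i. x $ i - 1 < t $ i \<and> t $ i \<le> x $ i + 1}"

text \<open>Read \<open>\<omega>\<close> as an instruction to shift each class with bit True down by
  1: in the shifted tiling exactly one cube contains \<open>x\<close>, and it is the one whose word
  agrees with \<open>\<omega>\<close>.\<close>

lemma local_words_partition:
  assumes T: "tiles id T"
  shows "\<exists>!t. t \<in> T \<and> (\<forall>i. x $ i - 1 < t $ i \<and> t $ i \<le> x $ i + 1) \<and> \<omega> \<in> cyl (word x t)"
proof -
  \<comment> \<open>The representative of \<open>r\<close> modulo 1 that \<open>word\<close> uses as
    class name.\<close>
  define rep where "rep i r = r - of_int \<lceil>r - x $ i\<rceil>" for i r
  define h where "h i r = (if \<omega> i (rep i r) then - 1 else 0 :: real)" for i r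
  have per: "rep i (r + of_int k) = rep i r" for i r k
  proof -
    have "\<lceil>r + of_int k - x $ i\<rceil> = \<lceil>r - x $ i\<rceil> + k"
      using ceiling_add_of_int[of "r - x $ i" k] by (simp add: algebra_simps)
    then show ?thesis by (simp add: rep_def)
  qed
  then have hper: "h i (r + of_int k) = h i r" for i r k by (simp add: h_def)
  have t: "tiles (\<lambda>t. \<chi> i. t $ i + h i (t $ i)) T" by (rule tiles_shift_all[OF T hper])
  have rep: "x $ i - 1 < rep i r" "rep i r \<le> x $ i" for i r unfolding rep_def by linarith+
  have eq: "covers (\<chi> i. t $ i + h i (t $ i)) x \<longleftrightarrow>
      (\<forall>i. x $ i - 1 < t $ i \<and> t $ i \<le> x $ i + 1) \<and> \<omega> \<in> cyl (word x t)" for t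
  proof -
    have "t $ i + h i (t $ i) \<le> x $ i \<and> x $ i < t $ i + h i (t $ i) + 1 \<longleftrightarrow>
      (x $ i - 1 < t $ i \<and> t $ i \<le> x $ i + 1) \<and> \<omega> i (fst (word x t i)) = snd (word x t i)" for i
    proof -
      have r1: "rep i (t $ i) = t $ i" if "x $ i - 1 < t $ i" "t $ i \<le> x $ i"
      proof -
        have "\<lceil>t $ i - x $ i\<rceil> = 0" using that by linarith
        then show ?thesis by (simp add: rep_def)
      qed
      have r2: "rep i (t $ i) = t $ i - 1" if "x $ i < t $ i" "t $ i \<le> x $ i + 1"
      proof -
        have "\<lceil>t $ i - x $ i\<rceil> = 1" using that by linarith
        then show ?thesis by (simp add: rep_def)
      qed
      \<comment> \<open>In the outer cases neither shift, by 0 or by -1, brings the cube over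
        \<open>x\<close>.\<close>
      consider "t $ i \<le> x $ i - 1" | "x $ i - 1 < t $ i" "t $ i \<le> x $ i"
        | "x $ i < t $ i" "t $ i \<le> x $ i + 1" | "t $ i > x $ i + 1" by linarith
      then show ?thesis
      proof cases
        case 2 with r1 show ?thesis by (auto simp: h_def word_def)
      next
        case 3 with r2 show ?thesis by (auto simp: h_def word_def)
      qed (auto simp: h_def)
    qed
    then show ?thesis by (auto simp: covers_def cyl_def)
  qed
  from t have "\<exists>!t. t \<in> T \<and> covers (\<chi> i. t $ i + h i (t $ i)) x" unfolding tiles_def by blast
  then show ?thesis unfolding eq .
qed

lemma local_words_code:
  assumes T: "tiles id T"
  shows "code (local_words T x)" "region (local_words T x) = UNIV"
proof -
  show "code (local_words T x)"
    unfolding code_def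
  proof (intro ballI impI)
    fix v w assume a: "v \<in> local_words T x" "w \<in> local_words T x" "v \<noteq> w"
    show "clash v w"
    proof (rule ccontr)
      assume "\<not> clash v w"
      then obtain \<omega> where "\<omega> \<in> cyl v" "\<omega> \<in> cyl w" using not_clash_point by blast
      with a local_words_partition[OF T, of x \<omega>] show False
        by (auto simp: local_words_def)
    qed
  qed
  show "region (local_words T x) = UNIV"
  proof (intro set_eqI iffI UNIV_I)
    fix \<omega> show "\<omega> \<in> region (local_words T x)"
      using local_words_partition[OF T, of x \<omega>] by (auto simp: region_def local_words_def)
  qed
qed

text \<open>Reversing one bit within a class moves the cube by exactly 1 in that coordinate.\<close>

lemma local_words_twin_free:
  assumes n: "\<not> (\<exists>t\<in>T. \<exists>s\<in>T. twin_pair t s)"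
  shows "twin_free (local_words T x)"
  unfolding twin_free_def
proof (intro ballI allI notI)
  fix v j assume a: "v \<in> local_words T x" "v(j := opp (v j)) \<in> local_words T x"
  then obtain t s where t: "t \<in> T" "v = word x t" and s: "s \<in> T" "v(j := opp (v j)) = word x s"
    unfolding local_words_def by blast
  have e: "word x s i = (if i = j then opp (word x t i) else word x t i)" for i
    using s(2) t(2) by (metis fun_upd_other fun_upd_same)
  have "\<bar>t $ j - s $ j\<bar> = 1" using e[of j] by (auto simp: word_def opp_def split: if_splits)
  moreover have "t $ i = s $ i" if "i \<noteq> j" for i
    using e[of i] that by (auto simp: word_def split: if_splits)
  ultimately show False using n t s unfolding twin_pair_def by blast
qed

text \<open>An element of \<open>L T x i\<close> is a class occurring with bit False at
  \<open>i\<close>. As the words cover everything, its two slices are rivals, of at least 12 words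
  each; different classes use different words, and a code has at most
  \<open>2 ^ CARD('n)\<close>.\<close>

lemma card_L_bound:
  fixes T :: "(real ^ 'n) set"
  assumes T: "tiles id T" and n: "\<not> (\<exists>t\<in>T. \<exists>s\<in>T. twin_pair t s)"
  shows "24 * card (L T x i) \<le> 2 ^ CARD('n)"
proof -
  let ?S = "local_words T x"
  note S = local_words_code[OF T, of x] local_words_twin_free[OF n, of x]
  let ?c = "\<lambda>r. slice ?S i (r, False)"
  have fin: "finite ?S" using S(1) by (rule finite_code)
  have mem: "?c r \<noteq> {}" if r: "r \<in> L T x i" for r
  proof -
    obtain t where "t \<in> T" "\<forall>i. x $ i - 1 < t $ i \<and> t $ i \<le> x $ i + 1" "t $ i \<le> x $ i" "r = t $ i"
      using r unfolding L_def closed_cube_meets by blast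
    then have "word x t \<in> ?c r" by (auto simp: slice_def local_words_def word_def)
    then show ?thesis by blast
  qed
  have ge: "card (?c r) \<ge> 12" "card (slice ?S i (opp (r, False))) = card (?c r)" if "r \<in> L T x i" for r
  proof -
    have bit: "\<omega> \<in> region (?c r) \<longleftrightarrow> \<omega> \<in> region (opp_slice ?S i (r, False))" for \<omega>
      using flip_in_slice[OF S(1), of \<omega> i "(r, False)"] flip_in_opp_slice[OF S(1), of \<omega> i "(r, False)"] S(2)
      by auto
    then have eq: "region (?c r) = region (opp_slice ?S i (r, False))" by blast
    have R: "rival (?c r) (opp_slice ?S i (r, False))"
      unfolding rival_def using S eq
      by (simp add: code_slice code_opp_slice twin_free_slice twin_free_opp_slice slice_opp_slice_disjoint)
    then show "card (?c r) \<ge> 12" using mem[OF that] by (rule rival_card)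
    show "card (slice ?S i (opp (r, False))) = card (?c r)"
      using card_code(1)[of "?c r"] card_code(1)[of "opp_slice ?S i (r, False)"] R eq
      by (simp add: rival_def card_opp_slice)
  qed
  let ?U = "\<lambda>r. {v \<in> ?S. fst (v i) = r}"
  have U: "24 \<le> card (?U r)" if "r \<in> L T x i" for r
    using slices_card[OF fin, of i "(r, False)"] ge[OF that] by simp
  have "finite (L T x i)"
  proof (rule finite_subset)
    show "L T x i \<subseteq> (\<lambda>v. fst (v i)) ` ?S"
    proof
      fix r assume "r \<in> L T x i"
      then obtain v where "v \<in> ?c r" using mem by blast
      then have "v \<in> ?S" "r = fst (v i)" by (auto simp: slice_def)
      then show "r \<in> (\<lambda>v. fst (v i)) ` ?S" by blast
    qed
  qed (use fin in simp)
  then have "card (\<Union>r\<in>L T x i. ?U r) = (\<Sum>r\<in>L T x i. card (?U r))"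
    by (intro card_UN_disjoint) (use fin in auto)
  also have "\<dots> \<ge> (\<Sum>r\<in>L T x i. 24)" by (rule sum_mono) (rule U)
  finally have "24 * card (L T x i) \<le> card (\<Union>r\<in>L T x i. ?U r)" by simp
  also have "\<dots> \<le> card ?S" by (rule card_mono) (use fin in auto)
  also have "\<dots> \<le> card (UNIV :: ('n \<Rightarrow> bool) set)"
    using card_code(1)[OF S(1)] by (simp add: card_mono)
  also have "\<dots> = 2 ^ CARD('n)" by (simp add: card_fun)
  finally show ?thesis .
qed

theorem theorem5p2:
  fixes T :: "(real ^ 'n) set"
  assumes "cube_tiling T"
    and "real (r_plus T) > 2 powi (int CARD('n) - 3) / 3"
  shows "\<exists>t\<in>T. \<exists>s\<in>T. twin_pair t s"
proof (rule ccontr)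
  assume n: "\<not> ?thesis"
  note b = card_L_bound[OF cube_tiling_tiles[OF assms(1)] n]
  let ?M = "\<lambda>x. MAX i. card (L T x i)"
  have M: "\<exists>i. ?M x = card (L T x i)" for x
  proof -
    have "?M x \<in> range (\<lambda>i. card (L T x i))" by (rule Max_in) auto
    then show ?thesis by (rule imageE) (rule exI)
  qed
  \<comment> \<open>A bound uniform in \<open>x\<close> makes the range finite, so that the outer
    maximum is attained.\<close>
  have "?M x \<le> 2 ^ CARD('n)" for x
  proof -
    obtain i where "?M x = card (L T x i)" using M by blast
    then show ?thesis using b[of x i] by linarith
  qed
  then have "range ?M \<subseteq> {..2 ^ CARD('n)}" by blast
  then have "finite (range ?M)" using finite_subset by blast
  then have "r_plus T \<in> range ?M" unfolding r_plus_def by (intro Max_in) auto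
  then obtain x where x: "r_plus T = ?M x" by blast
  obtain i where "?M x = card (L T x i)" using M by blast
  with x have "r_plus T = card (L T x i)" by simp
  then have "24 * r_plus T \<le> 2 ^ CARD('n)" using b by simp
  then have "real (24 * r_plus T) \<le> real (2 ^ CARD('n))" by (simp only: of_nat_le_iff)
  then have "24 * real (r_plus T) \<le> 2 ^ CARD('n)" by simp
  \<comment> \<open>A third of this is the bound \<open>2 ^ CARD('n) / 24\<close> just
    obtained.\<close>
  moreover have "(2::real) powi (int CARD('n) - 3) = 2 ^ CARD('n) / 8"
    by (simp add: power_int_diff)
  ultimately show False using assms(2) by simp
qed

end
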